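(* Let $\theta$ be a positive integer and suppose $X_\theta\sim F_\theta$, where $F_\theta$ is the limiting spectral distribution of $A_n^\theta$. Let $B\sim\mathrm{Ber}(1/\theta)$, let $\mathcal{R}$ have the symmetrized standard Rayleigh distribution with density $f(x)=|x|e^{-x^2}$, $-\infty<x<\infty$, and let $B$ and $\mathcal{R}$ be independent. Then $X_\theta\stackrel{d}{=}B\sqrt{\theta}\,\mathcal{R}$.
   Context: For $\theta\in(0,\infty)$ and $n$ large enough that $\lfloor n/\theta\rfloor\ge1$, let $L_\theta(i,j)=(i+j)\bmod\lfloor n/\theta\rfloor$ for $1\le i,j\le n$, and $A_n^\theta=n^{-1/2}((x_{L_\theta(i,j)}))_{1\le i,j\le n}$, where the real random variables $\{x_i\}_{i\ge0}$ satisfy one of: (1) independent, uniformly bounded, mean $0$, variance $1$; (2) i.i.d. with mean $0$ and variance $1$; (3) independent with mean $0$, variance $1$ and uniformly bounded moments of all orders. The limiting spectral distribution (LSD) $F_\theta$ is the non-random distribution function to which, almost surely, the empirical spectral distribution of $A_n^\theta$ (the distribution function of the uniform measure on its $n$ eigenvalues, with multiplicity) converges weakly as $n\to\infty$; it exists and does not depend on the choice of such input sequence. $\mathrm{Ber}(p)$ denotes the distribution on $\{0,1\}$ with mass $p$ at $1$. *)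

theory Defs
  imports "HOL-Probability.Probability" "Jordan_Normal_Form.Char_Poly"
begin

definition standardized :: "'a measure \<Rightarrow> ('a \<Rightarrow> real) \<Rightarrow> bool" where
  "standardized M X \<longleftrightarrow>
     integrable M X \<and> integrable M (\<lambda>\<omega>. (X \<omega>)\<^sup>2) \<and>
     prob_space.expectation M X = 0 \<and> prob_space.variance M X = 1"

definition independent_standardized :: "'a measure \<Rightarrow> (nat \<Rightarrow> 'a \<Rightarrow> real) \<Rightarrow> bool" where
  "independent_standardized M x \<longleftrightarrow>
     prob_space.indep_vars M (\<lambda>_. borel) x UNIV \<and> (\<forall>i. standardized M (x i))"

text \<open>The three admissible kinds of input sequence; "uniformly bounded" is meant
  almost surely.\<close>

definition bounded_input :: "'a measure \<Rightarrow> (nat \<Rightarrow> 'a \<Rightarrow> real) \<Rightarrow> bool" where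
  "bounded_input M x \<longleftrightarrow>
     independent_standardized M x \<and> (\<exists>C. \<forall>i. AE \<omega> in M. \<bar>x i \<omega>\<bar> \<le> C)"

definition iid_input :: "'a measure \<Rightarrow> (nat \<Rightarrow> 'a \<Rightarrow> real) \<Rightarrow> bool" where
  "iid_input M x \<longleftrightarrow>
     independent_standardized M x \<and> (\<forall>i. distr M borel (x i) = distr M borel (x 0))"

definition bounded_moments_input :: "'a measure \<Rightarrow> (nat \<Rightarrow> 'a \<Rightarrow> real) \<Rightarrow> bool" where
  "bounded_moments_input M x \<longleftrightarrow>
     independent_standardized M x \<and>
     (\<forall>p::nat. \<exists>C. \<forall>i. integrable M (\<lambda>\<omega>. \<bar>x i \<omega>\<bar> ^ p) \<and>
                     prob_space.expectation M (\<lambda>\<omega>. \<bar>x i \<omega>\<bar> ^ p) \<le> C)"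

definition input_sequence :: "'a measure \<Rightarrow> (nat \<Rightarrow> 'a \<Rightarrow> real) \<Rightarrow> bool" where
  "input_sequence M x \<longleftrightarrow> prob_space M \<and>
     (bounded_input M x \<or> iid_input M x \<or> bounded_moments_input M x)"

definition link :: "real \<Rightarrow> nat \<Rightarrow> nat \<Rightarrow> nat \<Rightarrow> nat" where
  "link \<theta> n i j = (i + j) mod nat \<lfloor>real n / \<theta>\<rfloor>"

text \<open>Matrices are indexed from 0, hence the shifts by one. When the modulus
  \<open>\<lfloor>n / \<theta>\<rfloor>\<close> is 0 the matrix is an irrelevant junk value, as only the limit
  \<open>n \<rightarrow> \<infinity>\<close> matters.\<close>

definition A_matrix :: "real \<Rightarrow> (nat \<Rightarrow> real) \<Rightarrow> nat \<Rightarrow> real mat" where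
  "A_matrix \<theta> a n = mat n n (\<lambda>(i, j). a (link \<theta> n (Suc i) (Suc j)) / sqrt (real n))"

text \<open>For a real symmetric matrix, all roots of the characteristic polynomial are
  real, so \<open>proots\<close> is the multiset of all eigenvalues with multiplicity.\<close>

definition ESD :: "real mat \<Rightarrow> real \<Rightarrow> real" where
  "ESD A = cdf (measure_pmf (pmf_of_multiset (proots (char_poly A))))"

definition is_LSD ::
    "'a measure \<Rightarrow> (nat \<Rightarrow> 'a \<Rightarrow> real) \<Rightarrow> real \<Rightarrow> (real \<Rightarrow> real) \<Rightarrow> bool" where
  "is_LSD M x \<theta> F \<longleftrightarrow>
     (\<exists>\<mu>. real_distribution \<mu> \<and> F = cdf \<mu>) \<and>
     (AE \<omega> in M. weak_conv (\<lambda>n. ESD (A_matrix \<theta> (\<lambda>i. x i \<omega>) n)) F)"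

definition Ber :: "real \<Rightarrow> real measure" where
  "Ber p = distr (measure_pmf (bernoulli_pmf p)) borel of_bool"

definition sym_rayleigh_density :: "real \<Rightarrow> real" where
  "sym_rayleigh_density x = \<bar>x\<bar> * exp (- (x\<^sup>2))"

end

theory Submission
  imports Defs
begin

text \<open>
  Since the almost sure limit is given, it is enough to identify it along \<open>n = \<theta>m\<close>. There the matrix
  is an \<open>n \<times> n\<close> reverse circulant with an \<open>m\<close>-periodic symbol, so its eigenvalues are \<open>\<plusminus>\<bar>\<lambda>\<^sub>k\<bar>\<close>,
  with \<open>\<lambda>\<^sub>k\<close> the Fourier coefficients of the symbol; these vanish unless \<open>\<theta>\<close> divides \<open>k\<close>, and
  otherwise are \<open>\<surd>\<theta>\<close> times (up to a phase) the normalised Fourier coefficients \<open>Z\<^sub>k\<close> of the input of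
  length \<open>m\<close>. The sign pairing makes the limit symmetric, so it is determined by the integrals of
  \<open>exp (-s x\<^sup>2)\<close> for natural \<open>s\<close>. These converge by bounded convergence together with their expectations:
  writing \<open>exp (-s \<bar>Z\<^sub>k\<bar>\<^sup>2)\<close> as a Gaussian average of \<open>exp (i(uZ' + vZ''))\<close> with \<open>Z', Z''\<close> the real and
  imaginary parts, a Lindeberg estimate of the characteristic function shows that its mean tends to
  \<open>1 / (1 + s)\<close>, the value for a squared Rayleigh variable.
\<close>

section \<open>Spectrum of a reverse circulant matrix\<close>

lemma sum_cis_progression:
  fixes q :: int
  assumes "0 < n"
  shows "(\<Sum>i<n. cis (2 * pi * of_int q * real i / real n)) = (if int n dvd q then of_nat n else 0)"
proof -
  define z where "z = cis (2 * pi * of_int q / real n)"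
  have cis_eq: "cis (2 * pi * of_int q * real i / real n) = z ^ i" for i
    by (simp add: z_def Complex.DeMoivre field_simps)
  have "z ^ n = 1"
    using assms by (simp add: z_def Complex.DeMoivre cis_multiple_2pi)
  have eq1: "z = 1 \<longleftrightarrow> int n dvd q"
  proof
    assume "z = 1"
    then have "cos (2 * pi * of_int q / real n) = 1"
      by (metis Re_complex_of_real cis.simps(1) one_complex.simps(1) z_def)
    then obtain k :: int where "2 * pi * of_int q / real n = of_int k * 2 * pi"
      unfolding cos_one_2pi_int by blast
    then have "real_of_int q = of_int (k * int n)"
      using assms by (simp add: field_simps)
    then show "int n dvd q"
      by (metis dvd_triv_right of_int_eq_iff)
  next
    assume "int n dvd q"
    then obtain k where "q = int n * k" by blast
    then have "2 * pi * of_int q / real n = 2 * pi * of_int k"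
      using assms by simp
    then show "z = 1"
      unfolding z_def by (metis Ints_of_int cis_multiple_2pi)
  qed
  show ?thesis
  proof (cases "z = 1")
    case False
    then show ?thesis
      using \<open>z ^ n = 1\<close> eq1 by (simp add: cis_eq geometric_sum)
  qed (use eq1 in \<open>simp add: cis_eq\<close>)
qed

lemma sum_cos_progression:
  fixes q :: int and c :: real
  assumes "0 < n"
  shows "(\<Sum>i<n. cos (2 * pi * of_int q * real i / real n + c)) = (if int n dvd q then real n * cos c else 0)"
proof -
  have "(\<Sum>i<n. cos (2 * pi * of_int q * real i / real n + c)) =
      Re ((\<Sum>i<n. cis (2 * pi * of_int q * real i / real n)) * cis c)"
    by (simp add: sum_distrib_right cis_mult)
  then show ?thesis
    by (simp add: sum_cis_progression[OF assms])
qed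

text \<open>Unnormalised and with a positive sign in the exponent; square-root factors are attached
  where the transform is used.\<close>

definition dft :: "nat \<Rightarrow> (nat \<Rightarrow> real) \<Rightarrow> nat \<Rightarrow> complex" where
  "dft n b k = (\<Sum>l<n. of_real (b l) * cis (2 * pi * real k * real l / real n))"

lemma bij_betw_add_mod:
  assumes "0 < n"
  shows "bij_betw (\<lambda>j. (i + j) mod n) {..<n} {..<(n::nat)}"
proof -
  have le: "x = y" if "x < n" "y \<le> x" "(i + x) mod n = (i + y) mod n" for x y
  proof -
    have "n dvd x - y"
      using that mod_eq_dvd_iff_nat[of "i + y" "i + x" n] by simp
    then show ?thesis
      using that nat_dvd_not_less[of "x - y" n] by linarith
  qed
  have inj: "inj_on (\<lambda>j. (i + j) mod n) {..<n}"
  proof (rule inj_onI)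
    fix x y assume "x \<in> {..<n}" "y \<in> {..<n}" "(i + x) mod n = (i + y) mod n"
    then show "x = y"
      using le[of x y] le[of y x] by (cases "y \<le> x") auto
  qed
  moreover have "(\<lambda>j. (i + j) mod n) ` {..<n} = {..<n}"
    using assms inj by (intro endo_inj_surj) auto
  ultimately show ?thesis by (simp add: bij_betw_def)
qed

lemma cis_mod:
  assumes "0 < n"
  shows "cis (2 * pi * real k * real (p mod n) / real n) = cis (2 * pi * real k * real p / real n)"
proof -
  have "real p = real n * real (p div n) + real (p mod n)"
    by (metis of_nat_add of_nat_mult mult_div_mod_eq)
  then have "2 * pi * real k * real p / real n =
      2 * pi * real k * real (p mod n) / real n + 2 * pi * real (k * (p div n))"
    using assms by (simp add: field_simps)
  moreover have "cis (2 * pi * real (k * (p div n))) = 1"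
    using cis_multiple_2pi Ints_of_nat by blast
  ultimately show ?thesis
    by (simp add: cis_mult [symmetric] del: of_nat_mult)
qed

text \<open>The substitution l = (i + j) mod n, a bijection in j, shows that a reverse circulant
  matrix sends the Fourier vector of frequency k to a multiple of the conjugate vector. By
  \<open>cis_mod\<close> the reduction mod n does not affect the phase.\<close>

lemma dft_shift:
  assumes "0 < n"
  shows "(\<Sum>j<n. of_real (b ((i + j) mod n)) * cis (2 * pi * real k * real j / real n)) =
    cis (- (2 * pi * real k * real i / real n)) * dft n b k"
proof -
  let ?g = "\<lambda>l. of_real (b l) * cis (2 * pi * real k * real l / real n)"
  have shift: "of_real (b ((i + j) mod n)) * cis (2 * pi * real k * real j / real n) =
      cis (- (2 * pi * real k * real i / real n)) * ?g ((i + j) mod n)" for j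
  proof -
    have "cis (2 * pi * real k * real j / real n) =
      cis (- (2 * pi * real k * real i / real n)) * cis (2 * pi * real k * real (i + j) / real n)"
      by (simp add: cis_mult add_divide_distrib ring_distribs)
    then show ?thesis by (simp add: cis_mod[OF assms])
  qed
  have "(\<Sum>j<n. of_real (b ((i + j) mod n)) * cis (2 * pi * real k * real j / real n)) =
      cis (- (2 * pi * real k * real i / real n)) * (\<Sum>j<n. ?g ((i + j) mod n))"
    unfolding sum_distrib_left by (intro sum.cong refl shift)
  also have "(\<Sum>j<n. ?g ((i + j) mod n)) = dft n b k"
    unfolding dft_def by (rule sum.reindex_bij_betw[OF bij_betw_add_mod[OF assms]])
  finally show ?thesis .
qed

text \<open>Replacing k by n - k conjugates every root of unity in the sum, and \<open>b\<close> is
  real.\<close>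

lemma dft_reflect:
  assumes "0 < n" "k \<le> n"
  shows "dft n b (n - k) = cnj (dft n b k)"
proof -
  have "cis (2 * pi * real (n - k) * real l / real n) = cis (- (2 * pi * real k * real l / real n))" for l
  proof -
    have "2 * pi * real (n - k) * real l / real n = 2 * pi * real l + - (2 * pi * real k * real l / real n)"
      using assms by (simp add: of_nat_diff field_simps)
    moreover have "cis (2 * pi * real l) = 1"
      using cis_multiple_2pi Ints_of_nat by blast
    ultimately show ?thesis
      by (metis cis_mult mult_1)
  qed
  then show ?thesis by (simp add: dft_def cis_cnj)
qed

text \<open>For 0 < k < n with 2k \<noteq> n, the values at k and n - k add up to \<pi> / 2; this
  makes the two eigenvectors of the pair orthogonal.\<close>

definition phase :: "nat \<Rightarrow> (nat \<Rightarrow> real) \<Rightarrow> nat \<Rightarrow> real" where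
  "phase n b k =
    (if 0 < k \<and> 2 * k < n then - (Arg (dft n b k) / 2)
     else if n < 2 * k then Arg (dft n b (n - k)) / 2 + pi / 2 else 0)"

text \<open>The pair k, n - k carries plus and minus the common modulus, with plus at the smaller
  frequency. The self-paired frequencies 0 and n / 2 have a real coefficient whose sign has to be
  kept, hence \<open>Re\<close>.\<close>

definition rc_eigenvalue :: "nat \<Rightarrow> (nat \<Rightarrow> real) \<Rightarrow> nat \<Rightarrow> real" where
  "rc_eigenvalue n b k =
    (if 0 < k \<and> 2 * k < n then cmod (dft n b k)
     else if n < 2 * k then - cmod (dft n b k) else Re (dft n b k))"

text \<open>Frequencies 0 and n / 2 are their own reflections mod n, so the coefficient is its own
  conjugate.\<close>

lemma Im_dft_self_paired:
  assumes "0 < n" "k = 0 \<or> 2 * k = n"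
  shows "Im (dft n b k) = 0"
proof (cases "k = 0")
  case True
  then show ?thesis by (simp add: dft_def)
next
  case False
  then have "dft n b k = cnj (dft n b k)"
    using dft_reflect[OF assms(1), of k b] assms(2) by auto
  then show ?thesis by (metis Im_complex_of_real Reals_cases Reals_cnj_iff)
qed

text \<open>Even test functions of the eigenvalues therefore depend on the Fourier moduli
  alone.\<close>

lemma rc_eigenvalue_sq:
  assumes "0 < n"
  shows "(rc_eigenvalue n b k)\<^sup>2 = (cmod (dft n b k))\<^sup>2"
  using Im_dft_self_paired[OF assms, of k b]
  by (auto simp: rc_eigenvalue_def cmod_power2)

text \<open>With \<open>dft n b k = r e\<^sup>i\<^sup>\<alpha>\<close>, the matrix sends \<open>cos (2\<pi>ki/n + \<phi>)\<close> to
  \<open>r cos (2\<pi>ki/n - \<phi> - \<alpha>)\<close>, so \<open>\<phi> = -\<alpha>/2\<close> gives the eigenvalue \<open>r\<close> and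
  \<open>\<phi> = -\<alpha>/2 + \<pi>/2\<close> the eigenvalue \<open>-r\<close>; \<open>phase\<close> makes these choices for
  \<open>k\<close> and \<open>n - k\<close>, which carry conjugate Fourier coefficients.\<close>

lemma reverse_circulant_eigenvector:
  assumes "k < n"
  shows "(\<Sum>j<n. b ((i + j) mod n) * cos (2 * pi * real k * real j / real n + phase n b k)) =
    rc_eigenvalue n b k * cos (2 * pi * real k * real i / real n + phase n b k)"
proof -
  have n: "0 < n" using assms by simp
  let ?x = "2 * pi * real k * real i / real n" and ?\<phi> = "phase n b k"
  \<comment> \<open>As \<open>b\<close> is real, the cosine can be replaced by a complex exponential
    under \<open>Re\<close>, to which \<open>dft_shift\<close> applies.\<close>
  have "(\<Sum>j<n. b ((i + j) mod n) * cos (2 * pi * real k * real j / real n + ?\<phi>)) =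
      Re (\<Sum>j<n. cis ?\<phi> * (of_real (b ((i + j) mod n)) * cis (2 * pi * real k * real j / real n)))"
    by (simp add: cos_add algebra_simps)
  also have "\<dots> = Re (cis ?\<phi> * (cis (- ?x) * dft n b k))"
    by (simp only: sum_distrib_left[symmetric] dft_shift[OF n])
  also have "\<dots> = Re (cis (?\<phi> - ?x) * dft n b k)"
    by (simp only: mult.assoc[symmetric] cis_mult) simp
  also have "\<dots> = rc_eigenvalue n b k * cos (?x + ?\<phi>)"
  proof -
    consider "0 < k" "2 * k < n" | "n < 2 * k" | "k = 0 \<or> 2 * k = n" by linarith
    then show ?thesis
    proof cases
      case 1
      define r a where "r = cmod (dft n b k)" and "a = Arg (dft n b k)"
      have d: "dft n b k = of_real r * cis a"
        by (metis r_def a_def rcis_cmod_Arg rcis_def)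
      have \<phi>: "?\<phi> = - (a / 2)" and e: "rc_eigenvalue n b k = r"
        using 1 by (auto simp: phase_def rc_eigenvalue_def r_def a_def)
      have "Re (cis (?\<phi> - ?x) * dft n b k) = r * Re (cis (?\<phi> - ?x) * cis a)"
        by (simp add: d algebra_simps)
      also have "cis (?\<phi> - ?x) * cis a = cis (- (?x + ?\<phi>))"
        unfolding cis_mult \<phi> by (rule arg_cong[where f = cis]) (simp add: field_simps)
      finally show ?thesis by (simp only: e cis.simps cos_minus)
    next
      case 2
      define r a where "r = cmod (dft n b (n - k))" and "a = Arg (dft n b (n - k))"
      have "dft n b (n - k) = of_real r * cis a"
        by (metis r_def a_def rcis_cmod_Arg rcis_def)
      moreover have "dft n b k = cnj (dft n b (n - k))"
        using dft_reflect[OF n, of k b] assms by simp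
      ultimately have d: "dft n b k = of_real r * cis (- a)"
        by (simp add: cis_cnj)
      have \<phi>: "?\<phi> = a / 2 + pi / 2" and e: "rc_eigenvalue n b k = - r"
        using 2 by (auto simp: phase_def rc_eigenvalue_def a_def d norm_mult r_def)
      have "Re (cis (?\<phi> - ?x) * dft n b k) = r * Re (cis (?\<phi> - ?x) * cis (- a))"
        by (simp add: d algebra_simps)
      also have "cis (?\<phi> - ?x) * cis (- a) = cis (pi - (?x + ?\<phi>))"
        unfolding cis_mult \<phi> by (rule arg_cong[where f = cis]) (simp add: field_simps)
      finally show ?thesis by (simp add: e cos_diff)
    next
      case 3
      then have "phase n b k = 0" "rc_eigenvalue n b k = Re (dft n b k)"
        using assms by (auto simp: phase_def rc_eigenvalue_def)
      then show ?thesis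
        using Im_dft_self_paired[OF n 3, of b] by simp
    qed
  qed
  finally show ?thesis .
qed

text \<open>Both phases use the argument of the same coefficient, with opposite signs; the
  half-arguments cancel and \<pi> / 2 remains.\<close>

lemma phase_reflect:
  assumes "k < n" "l < n" "k \<noteq> l" "k + l = n"
  shows "cos (phase n b k + phase n b l) = 0"
proof -
  have *: "cos (phase n b k + phase n b l) = 0" if "k < n" "l < n" "k < l" "k + l = n" for k l
  proof -
    have "n - l = k" "0 < k" "2 * k < n" "\<not> 2 * l < n" "n < 2 * l" using that by auto
    then show ?thesis by (simp add: phase_def)
  qed
  show ?thesis
    using *[of k l] *[of l k] assms by (cases "k < l") (auto simp: add.commute)
qed

text \<open>Product-to-sum splits the terms into frequencies k - l and k + l. The first sum vanishes
  unless k = l. The second vanishes unless k + l is 0 or n, and then \<open>phase_reflect\<close>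
  kills it, except for a self-paired k = l, where the phase is 0 and the squared norm
  doubles.\<close>

lemma reverse_circulant_orthogonal:
  assumes "k < n" "l < n"
  shows "(\<Sum>i<n. cos (2 * pi * real k * real i / real n + phase n b k) *
      cos (2 * pi * real l * real i / real n + phase n b l)) =
    (if k = l then (if k = 0 \<or> 2 * k = n then real n else real n / 2) else 0)"
proof -
  have n: "0 < n" using assms by simp
  let ?p = "phase n b k" and ?q = "phase n b l"
  have "(\<Sum>i<n. cos (2 * pi * real k * real i / real n + ?p) * cos (2 * pi * real l * real i / real n + ?q)) =
     ((\<Sum>i<n. cos (2 * pi * of_int (int k - int l) * real i / real n + (?p - ?q))) +
      (\<Sum>i<n. cos (2 * pi * of_int (int k + int l) * real i / real n + (?p + ?q)))) / 2"
    unfolding sum.distrib[symmetric] sum_divide_distrib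
    by (intro sum.cong refl)
       (simp add: cos_times_cos add_divide_distrib diff_divide_distrib algebra_simps)
  also have "\<dots> = ((if int n dvd int k - int l then real n * cos (?p - ?q) else 0) +
      (if int n dvd int k + int l then real n * cos (?p + ?q) else 0)) / 2"
    by (simp only: sum_cos_progression[OF n])
  also have "int n dvd int k - int l \<longleftrightarrow> k = l"
    using assms zdvd_imp_le[of "int n" "\<bar>int k - int l\<bar>"] by (cases "k = l") auto
  also have "int n dvd int k + int l \<longleftrightarrow> k + l = 0 \<or> k + l = n"
  proof
    assume "int n dvd int k + int l"
    then have "n dvd k + l" by (metis of_nat_add int_dvd_int_iff)
    then obtain c where c: "k + l = n * c" by blast
    then have "n * c < n * 2" using assms by linarith
    then have "c < 2" using n by simp
    then show "k + l = 0 \<or> k + l = n" using c by (auto simp: less_2_cases_iff)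
  qed (auto simp flip: of_nat_add)
  finally have eq: "(\<Sum>i<n. cos (2 * pi * real k * real i / real n + ?p) *
      cos (2 * pi * real l * real i / real n + ?q)) =
    ((if k = l then real n * cos (?p - ?q) else 0) +
      (if k + l = 0 \<or> k + l = n then real n * cos (?p + ?q) else 0)) / 2" .
  show ?thesis
  proof (cases "k = l")
    case True
    moreover have "phase n b k = 0" if "k = 0 \<or> 2 * k = n"
      using that by (auto simp: phase_def)
    moreover have "k + k = 0 \<or> k + k = n \<longleftrightarrow> k = 0 \<or> 2 * k = n" by linarith
    ultimately show ?thesis
      unfolding eq by (cases "k = 0 \<or> 2 * k = n") (simp_all only: if_True if_False, simp_all)
  next
    case False
    then show ?thesis
      unfolding eq using phase_reflect[OF assms False, of b] by simp
  qed
qed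

text \<open>Diagonalisation A = P D Q: the columns of \<open>P\<close> are the eigenvectors, and
  \<open>Q\<close> is the transpose of \<open>P\<close> with each row divided by the squared norm of
  its eigenvector, hence the inverse of \<open>P\<close> by orthogonality.\<close>

lemma char_poly_reverse_circulant:
  assumes n: "0 < n"
  shows "char_poly (mat n n (\<lambda>(i, j). b ((i + j) mod n))) =
    (\<Prod>k\<leftarrow>[0..<n]. [:- rc_eigenvalue n b k, 1:])"
proof -
  define A P Q D where
    "A = mat n n (\<lambda>(i, j). b ((i + j) mod n))" and
    "P = mat n n (\<lambda>(i, k). cos (2 * pi * real k * real i / real n + phase n b k))" and
    "Q = mat n n (\<lambda>(k, i). cos (2 * pi * real k * real i / real n + phase n b k) /
      (if k = 0 \<or> 2 * k = n then real n else real n / 2))" and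
    "D = mat n n (\<lambda>(i, j). if i = j then rc_eigenvalue n b i else 0)"
  have carrier: "A \<in> carrier_mat n n" "P \<in> carrier_mat n n" "Q \<in> carrier_mat n n" "D \<in> carrier_mat n n"
    by (auto simp: A_def P_def Q_def D_def)
  have QP: "Q * P = 1\<^sub>m n"
  proof (rule eq_matI)
    fix k l assume "k < dim_row (1\<^sub>m n :: real mat)" "l < dim_col (1\<^sub>m n :: real mat)"
    then have kl: "k < n" "l < n" by auto
    then have "(Q * P) $$ (k, l) = (\<Sum>i<n. cos (2 * pi * real k * real i / real n + phase n b k) *
      cos (2 * pi * real l * real i / real n + phase n b l)) / (if k = 0 \<or> 2 * k = n then real n else real n / 2)"
      by (simp add: Q_def P_def scalar_prod_def sum_divide_distrib lessThan_atLeast0)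
    also have "\<dots> = (1\<^sub>m n) $$ (k, l)"
      using kl n by (simp add: reverse_circulant_orthogonal)
    finally show "(Q * P) $$ (k, l) = (1\<^sub>m n) $$ (k, l)" .
  qed (use carrier in auto)
  then have PQ: "P * Q = 1\<^sub>m n"
    using mat_mult_left_right_inverse carrier by blast
  have "A * P = P * D"
  proof (rule eq_matI)
    fix i k assume "i < dim_row (P * D)" "k < dim_col (P * D)"
    then have ik: "i < n" "k < n" using carrier by auto
    then have "(A * P) $$ (i, k) =
       (\<Sum>j<n. b ((i + j) mod n) * cos (2 * pi * real k * real j / real n + phase n b k))"
      by (simp add: A_def P_def scalar_prod_def lessThan_atLeast0)
    also have "\<dots> = (P * D) $$ (i, k)"
      using ik by (simp add: reverse_circulant_eigenvector)
        (simp add: P_def D_def scalar_prod_def if_distrib[of "\<lambda>x. _ * x"] sum.delta cong: if_cong)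
    finally show "(A * P) $$ (i, k) = (P * D) $$ (i, k)" .
  qed (use carrier in auto)
  then have "A = P * D * Q"
    using carrier PQ by (metis assoc_mult_mat right_mult_one_mat)
  then have "similar_mat A D"
    using carrier PQ QP by (intro similar_matI[of _ _ P Q n]) auto
  then have "char_poly A = char_poly D" by (rule char_poly_similar)
  also have "\<dots> = (\<Prod>a\<leftarrow>diag_mat D. [:- a, 1:])"
    using carrier by (intro char_poly_upper_triangular[of _ n]) (auto simp: upper_triangular_def D_def)
  also have "diag_mat D = map (rc_eigenvalue n b) [0..<n]"
    by (auto simp: diag_mat_def D_def)
  finally show ?thesis by (simp add: A_def comp_def)
qed

text \<open>The linear factors of the characteristic polynomial contribute one root per frequency,
  with multiplicity, so spectral averages become averages over frequencies.\<close>

lemma expectation_eigenvalues_reverse_circulant: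
  fixes f :: "real \<Rightarrow> real"
  assumes "0 < n"
  shows "measure_pmf.expectation
      (pmf_of_multiset (proots (char_poly (mat n n (\<lambda>(i, j). b ((i + j) mod n)))))) f =
    (\<Sum>k<n. f (rc_eigenvalue n b k)) / real n"
proof -
  have "proots (char_poly (mat n n (\<lambda>(i, j). b ((i + j) mod n)))) =
      sum_list (map (\<lambda>k. {#rc_eigenvalue n b k#}) [0..<n])"
    unfolding char_poly_reverse_circulant[OF assms]
    using proots_prod_list[of "map (\<lambda>k. [:- rc_eigenvalue n b k, 1:]) [0..<n]"]
    by (fastforce simp: comp_def)
  also have "\<dots> = image_mset (rc_eigenvalue n b) (mset_set {..<n})"
    by (simp add: lessThan_atLeast0)
  finally show ?thesis
    using assms by (simp add: map_pmf_of_set[symmetric] integral_pmf_of_set lessThan_empty_iff)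
qed

text \<open>The eigenvalues at k and n - k are opposite, so their contributions cancel; at most two
  self-paired frequencies, 0 and n / 2, remain.\<close>

lemma odd_sum_reverse_circulant:
  fixes h :: "real \<Rightarrow> real"
  assumes n: "0 < n" and odd: "\<And>x. h (- x) = - h x" and bound: "\<And>x. \<bar>h x\<bar> \<le> C"
  shows "\<bar>\<Sum>k<n. h (rc_eigenvalue n b k)\<bar> \<le> 2 * C"
proof -
  let ?e = "\<lambda>k. h (rc_eigenvalue n b k)"
  define P N S where
    "P = {k. 0 < k \<and> 2 * k < n}" and
    "N = {k. k < n \<and> n < 2 * k}" and
    "S = {k. k < n \<and> (k = 0 \<or> 2 * k = n)}"
  have split: "{..<n} = (P \<union> N) \<union> S"
    by (auto simp: P_def N_def S_def)
  have "P \<subseteq> {..<n}" "N \<subseteq> {..<n}"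
    by (auto simp: P_def N_def)
  then have fin: "finite P" "finite N"
    using finite_subset by blast+
  have sub: "S \<subseteq> {0, n div 2}" by (auto simp: S_def)
  have S: "finite S" "card S \<le> 2"
    using sub finite_subset apply blast
    using card_mono[OF _ sub] card_length[of "[0, n div 2]"] by simp
  have "(\<Sum>k\<in>P. ?e k) = (\<Sum>k\<in>N. - ?e k)"
  proof (rule sum.reindex_bij_witness[of _ "\<lambda>k. n - k" "\<lambda>k. n - k"])
    fix k assume "k \<in> P"
    then have k: "0 < k" "2 * k < n" by (auto simp: P_def)
    then have "rc_eigenvalue n b (n - k) = - rc_eigenvalue n b k"
      using dft_reflect[OF n, of k b] by (auto simp: rc_eigenvalue_def)
    then show "- ?e (n - k) = ?e k" by (simp add: odd)
  qed (auto simp: P_def N_def)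
  moreover have "(\<Sum>k<n. ?e k) = (\<Sum>k\<in>P \<union> N. ?e k) + (\<Sum>k\<in>S. ?e k)"
    unfolding split by (rule sum.union_disjoint) (use fin S in \<open>auto simp: P_def N_def S_def\<close>)
  moreover have "(\<Sum>k\<in>P \<union> N. ?e k) = (\<Sum>k\<in>P. ?e k) + (\<Sum>k\<in>N. ?e k)"
    by (rule sum.union_disjoint) (use fin in \<open>auto simp: P_def N_def\<close>)
  ultimately have "(\<Sum>k<n. ?e k) = (\<Sum>k\<in>S. ?e k)"
    by (simp add: sum_negf)
  also have "\<bar>\<dots>\<bar> \<le> (\<Sum>k\<in>S. C)"
    by (rule order_trans[OF sum_abs]) (rule sum_mono, rule bound)
  also have "\<dots> \<le> 2 * C"
    using S bound[of 0] by (auto intro!: mult_right_mono)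
  finally show ?thesis .
qed

section \<open>Gaussian limit of the discrete Fourier coefficients\<close>

text \<open>The upper bound results from the quadratic Taylor lower bound for exp y, the lower one
  from convexity.\<close>

lemma exp_minus_quadratic_approx:
  fixes y :: real
  assumes "0 \<le> y"
  shows "\<bar>exp (- y) - (1 - y)\<bar> \<le> y\<^sup>2 / 2"
proof -
  \<comment> \<open>The product equals 1 + y^4 / 4, and its first factor is ((y - 1)^2 + 1) / 2,
    hence nonnegative.\<close>
  have "1 \<le> (1 - y + y\<^sup>2 / 2) * (1 + y + y\<^sup>2 / 2)"
    using zero_le_power[OF assms, of 4] by (simp add: algebra_simps eval_nat_numeral)
  also have "\<dots> \<le> (1 - y + y\<^sup>2 / 2) * exp y"
    using exp_lower_Taylor_quadratic[OF assms] sum_power2_ge_zero[of "y - 1" 1]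
    by (intro mult_left_mono) (auto simp: power2_eq_square algebra_simps)
  finally have "exp (- y) \<le> 1 - y + y\<^sup>2 / 2"
    by (simp add: exp_minus field_simps)
  moreover have "1 - y \<le> exp (- y)"
    using exp_ge_add_one_self[of "- y"] by simp
  ultimately show ?thesis by simp
qed

section \<open>The Lindeberg condition for the three kinds of input\<close>

lemma (in prob_space) standardizedD:
  assumes "standardized M X"
  shows "integrable M X" "integrable M (\<lambda>\<omega>. (X \<omega>)\<^sup>2)" "expectation X = 0" "variance X = 1"
    and "expectation (\<lambda>\<omega>. (X \<omega>)\<^sup>2) = 1"
  using assms by (auto simp: standardized_def)

lemma (in prob_space) integrable_min_cube:
  fixes X :: "'a \<Rightarrow> real"
  assumes "standardized M X" "0 \<le> d"
  shows "integrable M (\<lambda>\<omega>. min (6 * (X \<omega>)\<^sup>2) (d * \<bar>X \<omega>\<bar> ^ 3))"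
proof (rule Bochner_Integration.integrable_bound)
  show "integrable M (\<lambda>\<omega>. 6 * (X \<omega>)\<^sup>2)"
    using standardizedD[OF assms(1)] by simp
  show "(\<lambda>\<omega>. min (6 * (X \<omega>)\<^sup>2) (d * \<bar>X \<omega>\<bar> ^ 3)) \<in> borel_measurable M"
    using standardizedD(1)[OF assms(1)] by measurable
qed (use assms in \<open>auto simp: min_def\<close>)

text \<open>The minimum is the remainder in the Taylor estimate \<open>char_approx3'\<close> of a
  characteristic function. It switches at size 6 / \<delta> from a small multiple of the third
  moment to the second-moment tail, so its smallness, uniformly in the index, is a form of
  Lindeberg's condition.\<close>

definition uniform_Lindeberg :: "'a measure \<Rightarrow> (nat \<Rightarrow> 'a \<Rightarrow> real) \<Rightarrow> bool" where
  "uniform_Lindeberg M x \<longleftrightarrow> (\<forall>\<epsilon>>0. \<exists>\<delta>>0. \<forall>i.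
     prob_space.expectation M (\<lambda>\<omega>. min (6 * (x i \<omega>)\<^sup>2) (\<delta> * \<bar>x i \<omega>\<bar> ^ 3)) \<le> \<epsilon>)"

lemma (in prob_space) uniform_Lindeberg_linear:
  assumes "\<And>\<delta> i. 0 < \<delta> \<Longrightarrow> expectation (\<lambda>\<omega>. min (6 * (x i \<omega>)\<^sup>2) (\<delta> * \<bar>x i \<omega>\<bar> ^ 3)) \<le> \<delta> * C"
  shows "uniform_Lindeberg M x"
  unfolding uniform_Lindeberg_def
proof (intro allI impI)
  fix \<epsilon> :: real assume "0 < \<epsilon>"
  \<comment> \<open>The summand 1 keeps the denominator positive whatever \<open>C\<close>
    is.\<close>
  define \<delta> where "\<delta> = \<epsilon> / (\<bar>C\<bar> + 1)"
  have "0 < \<delta>" using \<open>0 < \<epsilon>\<close> by (simp add: \<delta>_def)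
  have "\<delta> * C \<le> \<delta> * (\<bar>C\<bar> + 1)"
    using \<open>0 < \<delta>\<close> by (intro mult_left_mono) auto
  also have "\<dots> = \<epsilon>" by (simp add: \<delta>_def)
  finally have "\<delta> * C \<le> \<epsilon>" .
  then show "\<exists>\<delta>>0. \<forall>i. expectation (\<lambda>\<omega>. min (6 * (x i \<omega>)\<^sup>2) (\<delta> * \<bar>x i \<omega>\<bar> ^ 3)) \<le> \<epsilon>"
    using assms[OF \<open>0 < \<delta>\<close>] \<open>0 < \<delta>\<close> order_trans by blast
qed

text \<open>For bounded inputs the cube is at most C x^2, and for bounded moments the third moment
  is at most C, so the bound is linear in \<delta>. For identically distributed inputs one variable
  decides, by dominated convergence.\<close>

lemma (in prob_space) input_sequence_uniform_Lindeberg: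
  assumes "input_sequence M x"
  shows "uniform_Lindeberg M x"
proof -
  have std: "standardized M (x i)" for i
    using assms by (auto simp: input_sequence_def bounded_input_def iid_input_def
        bounded_moments_input_def independent_standardized_def)
  note int_min = integrable_min_cube[OF std]
  have [measurable]: "x i \<in> borel_measurable M" for i
    using standardizedD(1)[OF std] by auto
  consider "bounded_input M x" | "iid_input M x" | "bounded_moments_input M x"
    using assms by (auto simp: input_sequence_def)
  then show ?thesis
  proof cases
    case 1
    then obtain C where C: "AE \<omega> in M. \<bar>x i \<omega>\<bar> \<le> C" for i
      by (auto simp: bounded_input_def)
    show ?thesis
    proof (rule uniform_Lindeberg_linear)
      fix d :: real and i assume d: "0 < d"
      have "expectation (\<lambda>\<omega>. min (6 * (x i \<omega>)\<^sup>2) (d * \<bar>x i \<omega>\<bar> ^ 3)) \<le> expectation (\<lambda>\<omega>. d * C * (x i \<omega>)\<^sup>2)"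
      proof (rule integral_mono_AE)
        show "AE \<omega> in M. min (6 * (x i \<omega>)\<^sup>2) (d * \<bar>x i \<omega>\<bar> ^ 3) \<le> d * C * (x i \<omega>)\<^sup>2"
          using C[of i]
        proof eventually_elim
          case (elim \<omega>)
          have "\<bar>x i \<omega>\<bar> ^ 3 = \<bar>x i \<omega>\<bar> * (x i \<omega>)\<^sup>2"
            by (simp add: power3_eq_cube power2_eq_square)
          also have "\<dots> \<le> C * (x i \<omega>)\<^sup>2"
            using elim by (intro mult_right_mono) auto
          finally show ?case
            using d by (simp add: min_le_iff_disj mult.assoc)
        qed
      qed (use d int_min standardizedD(2)[OF std] in auto)
      also have "\<dots> = d * C"
        using standardizedD(5)[OF std] by simp
      finally show "expectation (\<lambda>\<omega>. min (6 * (x i \<omega>)\<^sup>2) (d * \<bar>x i \<omega>\<bar> ^ 3)) \<le> d * C" .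
    qed
  next
    case 2
    let ?g = "\<lambda>d y :: real. min (6 * y\<^sup>2) (d * \<bar>y\<bar> ^ 3)"
    have same: "expectation (\<lambda>\<omega>. ?g d (x i \<omega>)) = expectation (\<lambda>\<omega>. ?g d (x 0 \<omega>))" for d i
    proof -
      have "expectation (\<lambda>\<omega>. ?g d (x i \<omega>)) = (\<integral>y. ?g d y \<partial>distr M borel (x i))"
        by (simp add: integral_distr)
      also have "\<dots> = (\<integral>y. ?g d y \<partial>distr M borel (x 0))"
        using conjunct2[OF 2[unfolded iid_input_def], rule_format, of i] by (simp only:)
      also have "\<dots> = expectation (\<lambda>\<omega>. ?g d (x 0 \<omega>))"
        by (simp add: integral_distr)
      finally show ?thesis .
    qed
    \<comment> \<open>Here \<delta> runs through 1 / (n + 1), and the dominating function is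
      integrable because the second moment is finite.\<close>
    have "(\<lambda>n. expectation (\<lambda>\<omega>. ?g (inverse (real (Suc n))) (x 0 \<omega>))) \<longlonglongrightarrow> expectation (\<lambda>\<omega>. 0)"
    proof (rule integral_dominated_convergence[where w = "\<lambda>\<omega>. 6 * (x 0 \<omega>)\<^sup>2"])
      show "AE \<omega> in M. (\<lambda>n. ?g (inverse (real (Suc n))) (x 0 \<omega>)) \<longlonglongrightarrow> 0"
      proof (rule AE_I2)
        fix \<omega>
        have "(\<lambda>n. ?g (inverse (real (Suc n))) (x 0 \<omega>)) \<longlonglongrightarrow> min (6 * (x 0 \<omega>)\<^sup>2) (0 * \<bar>x 0 \<omega>\<bar> ^ 3)"
          by (intro tendsto_intros LIMSEQ_inverse_real_of_nat)
        then show "(\<lambda>n. ?g (inverse (real (Suc n))) (x 0 \<omega>)) \<longlonglongrightarrow> 0"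
          by simp
      qed
    qed (use standardizedD(2)[OF std] in \<open>auto simp: min_def\<close>)
    then have lim: "(\<lambda>n. expectation (\<lambda>\<omega>. ?g (inverse (real (Suc n))) (x 0 \<omega>))) \<longlonglongrightarrow> 0"
      by simp
    show ?thesis
      unfolding uniform_Lindeberg_def
    proof (intro allI impI)
      fix \<epsilon> :: real assume "0 < \<epsilon>"
      then obtain n where n: "expectation (\<lambda>\<omega>. ?g (inverse (real (Suc n))) (x 0 \<omega>)) < \<epsilon>"
        using order_tendstoD(2)[OF lim] by (auto simp: eventually_sequentially)
      have "expectation (\<lambda>\<omega>. ?g (inverse (real (Suc n))) (x i \<omega>)) \<le> \<epsilon>" for i
        using n same[of i "inverse (real (Suc n))"] by linarith
      then show "\<exists>\<delta>>0. \<forall>i. expectation (\<lambda>\<omega>. ?g \<delta> (x i \<omega>)) \<le> \<epsilon>"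
        by (intro exI[of _ "inverse (real (Suc n))"]) auto
    qed
  next
    case 3
    then obtain C where C: "integrable M (\<lambda>\<omega>. \<bar>x i \<omega>\<bar> ^ 3)" "expectation (\<lambda>\<omega>. \<bar>x i \<omega>\<bar> ^ 3) \<le> C" for i
      by (metis bounded_moments_input_def)
    show ?thesis
    proof (rule uniform_Lindeberg_linear)
      fix d :: real and i assume d: "0 < d"
      have "expectation (\<lambda>\<omega>. min (6 * (x i \<omega>)\<^sup>2) (d * \<bar>x i \<omega>\<bar> ^ 3)) \<le> expectation (\<lambda>\<omega>. d * \<bar>x i \<omega>\<bar> ^ 3)"
        using d C int_min by (intro integral_mono) auto
      also have "\<dots> \<le> d * C"
        using d C by simp
      finally show "expectation (\<lambda>\<omega>. min (6 * (x i \<omega>)\<^sup>2) (d * \<bar>x i \<omega>\<bar> ^ 3)) \<le> d * C" .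
    qed
  qed
qed

text \<open>Mean 0 and variance 1 give both functions the same expansion 1 - t^2 / 2; the two
  remainders are compared separately. The factor t^2 in the bound makes the errors summable over
  many small coefficients.\<close>

lemma (in prob_space) char_standardized_approx:
  assumes X: "standardized M X" and t: "\<bar>t\<bar> \<le> \<delta>"
    and \<epsilon>: "expectation (\<lambda>\<omega>. min (6 * (X \<omega>)\<^sup>2) (\<delta> * \<bar>X \<omega>\<bar> ^ 3)) \<le> \<epsilon>"
  shows "cmod (char (distr M borel X) t - of_real (exp (- (t\<^sup>2 / 2)))) \<le> t\<^sup>2 * (\<epsilon> + \<delta>\<^sup>2)"
proof -
  note D = standardizedD[OF X]
  have "0 \<le> \<delta>" using t by linarith
  have "cmod (char (distr M borel X) t - (1 - t\<^sup>2 * 1 / 2)) \<le>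
      (t\<^sup>2 / 6) * expectation (\<lambda>\<omega>. min (6 * (X \<omega>)\<^sup>2) (\<bar>t\<bar> * \<bar>X \<omega>\<bar> ^ 3))"
    using char_approx3'[of X 1 "distr M borel X" t] D by simp
  also have "\<dots> \<le> (t\<^sup>2 / 6) * expectation (\<lambda>\<omega>. min (6 * (X \<omega>)\<^sup>2) (\<delta> * \<bar>X \<omega>\<bar> ^ 3))"
    using t \<open>0 \<le> \<delta>\<close>
    by (intro mult_left_mono integral_mono integrable_min_cube[OF X] min.mono mult_right_mono) auto
  also have "\<dots> \<le> (t\<^sup>2 / 6) * \<epsilon>"
    by (intro mult_left_mono \<epsilon>) auto
  finally have 1: "cmod (char (distr M borel X) t - (1 - t\<^sup>2 / 2)) \<le> t\<^sup>2 / 6 * \<epsilon>"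
    by simp
  have "cmod (of_real (exp (- (t\<^sup>2 / 2))) - (1 - t\<^sup>2 / 2)) = \<bar>exp (- (t\<^sup>2 / 2)) - (1 - t\<^sup>2 / 2)\<bar>"
    unfolding norm_of_real[symmetric, where 'a = complex] by simp
  also have "\<dots> \<le> (t\<^sup>2 / 2)\<^sup>2 / 2"
    by (rule exp_minus_quadratic_approx) simp
  also have "\<dots> \<le> t\<^sup>2 * \<delta>\<^sup>2 / 8"
    using power_mono[OF t, of 2] by (simp add: power2_eq_square mult_left_mono)
  finally have 2: "cmod (of_real (exp (- (t\<^sup>2 / 2))) - (1 - t\<^sup>2 / 2)) \<le> t\<^sup>2 * \<delta>\<^sup>2 / 8" .
  have "0 \<le> \<epsilon>"
    using \<open>0 \<le> \<delta>\<close> by (intro order_trans[OF _ \<epsilon>] integral_nonneg) auto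
  have "cmod (char (distr M borel X) t - of_real (exp (- (t\<^sup>2 / 2)))) \<le>
     cmod (char (distr M borel X) t - (1 - t\<^sup>2 / 2)) + cmod (of_real (exp (- (t\<^sup>2 / 2))) - (1 - t\<^sup>2 / 2))"
    using norm_triangle_ineq4[of "char (distr M borel X) t - (1 - t\<^sup>2 / 2)" "of_real (exp (- (t\<^sup>2 / 2))) - (1 - t\<^sup>2 / 2)"]
    by simp
  also have "\<dots> \<le> t\<^sup>2 / 6 * \<epsilon> + t\<^sup>2 * \<delta>\<^sup>2 / 8"
    by (intro add_mono 1 2)
  also have "\<dots> \<le> t\<^sup>2 * \<epsilon> + t\<^sup>2 * \<delta>\<^sup>2"
    using \<open>0 \<le> \<epsilon>\<close> by (intro add_mono) (auto simp: divide_right_mono mult_nonneg_nonneg)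
  finally show ?thesis by (simp add: ring_distribs)
qed

text \<open>Independence factorises the characteristic function. All factors have modulus at most 1,
  so the difference of the products is at most the sum of the differences.\<close>

lemma (in prob_space) char_linear_combination_approx:
  assumes x: "independent_standardized M x" and t: "\<And>l. l < m \<Longrightarrow> \<bar>t l\<bar> \<le> \<delta>"
    and \<epsilon>: "\<And>i. expectation (\<lambda>\<omega>. min (6 * (x i \<omega>)\<^sup>2) (\<delta> * \<bar>x i \<omega>\<bar> ^ 3)) \<le> \<epsilon>"
  shows "cmod ((CLINT \<omega>|M. iexp (\<Sum>l<m. t l * x l \<omega>)) - of_real (exp (- ((\<Sum>l<m. (t l)\<^sup>2) / 2)))) \<le>
    (\<Sum>l<m. (t l)\<^sup>2) * (\<epsilon> + \<delta>\<^sup>2)"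
proof -
  have indep: "indep_vars (\<lambda>_. borel) x UNIV" and std: "standardized M (x i)" for i
    using x by (auto simp: independent_standardized_def)
  have [measurable]: "x i \<in> borel_measurable M" for i
    using standardizedD(1)[OF std] by auto
  have indep_t: "indep_vars (\<lambda>_. borel) (\<lambda>l \<omega>. t l * x l \<omega>) {..<m}"
    by (rule indep_vars_compose2[OF indep_vars_subset[OF indep]]) auto
  have "(CLINT \<omega>|M. iexp (\<Sum>l<m. t l * x l \<omega>)) = char (distr M borel (\<lambda>\<omega>. \<Sum>l<m. t l * x l \<omega>)) 1"
    by (simp add: char_def integral_distr)
  also have "\<dots> = (\<Prod>l<m. char (distr M borel (\<lambda>\<omega>. t l * x l \<omega>)) 1)"
    by (rule char_distr_sum[OF indep_t])
  also have "\<dots> = (\<Prod>l<m. char (distr M borel (x l)) (t l))"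
    by (simp add: char_def integral_distr)
  finally have prod: "(CLINT \<omega>|M. iexp (\<Sum>l<m. t l * x l \<omega>)) = (\<Prod>l<m. char (distr M borel (x l)) (t l))" .
  have "of_real (exp (- ((\<Sum>l<m. (t l)\<^sup>2) / 2))) = (\<Prod>l<m. (of_real (exp (- ((t l)\<^sup>2 / 2))) :: complex))"
    by (simp only: sum_divide_distrib sum_negf[symmetric] exp_sum[OF finite_lessThan] of_real_prod)
  then have "cmod ((CLINT \<omega>|M. iexp (\<Sum>l<m. t l * x l \<omega>)) - of_real (exp (- ((\<Sum>l<m. (t l)\<^sup>2) / 2)))) \<le>
      (\<Sum>l<m. cmod (char (distr M borel (x l)) (t l) - of_real (exp (- ((t l)\<^sup>2 / 2)))))"
    unfolding prod
    by (simp only:, intro norm_prod_diff)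
       (auto intro!: real_distribution.cmod_char_le_1 real_distribution_distr)
  also have "\<dots> \<le> (\<Sum>l<m. (t l)\<^sup>2 * (\<epsilon> + \<delta>\<^sup>2))"
    by (intro sum_mono char_standardized_approx[OF std _ \<epsilon>] t) auto
  finally show ?thesis by (simp add: sum_distrib_right)
qed

text \<open>The double-frequency terms sum to 0 because m does not divide 2k. Hence the real and
  imaginary parts of a generic Fourier coefficient are uncorrelated with equal variance m /
  2.\<close>

lemma sum_sq_trig:
  assumes "0 < k" "k < m" "2 * k \<noteq> m"
  shows "(\<Sum>l<m. (u * cos (2 * pi * real k * real l / real m) + v * sin (2 * pi * real k * real l / real m))\<^sup>2) =
    real m * (u\<^sup>2 + v\<^sup>2) / 2"
proof -
  have m: "0 < m" using assms by simp
  have ndvd: "\<not> int m dvd int (2 * k)"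
  proof
    assume "int m dvd int (2 * k)"
    then have "m dvd 2 * k" by (simp only: int_dvd_int_iff)
    then obtain c where c: "2 * k = m * c" by blast
    then have "m * c < m * 2" "0 < c" using assms by (linarith, auto intro: gr0I)
    then have "c = 1" by simp
    then show False using c assms by simp
  qed
  \<comment> \<open>The phase - \<pi> / 2 writes the sine of the double angle as a cosine, so that
    \<open>sum_cos_progression\<close> covers both oscillating terms.\<close>
  have "(u * cos (2 * pi * real k * real l / real m) + v * sin (2 * pi * real k * real l / real m))\<^sup>2 =
     (u\<^sup>2 + v\<^sup>2) / 2 + (u\<^sup>2 - v\<^sup>2) / 2 * cos (2 * pi * of_int (int (2 * k)) * real l / real m + 0) +
     u * v * cos (2 * pi * of_int (int (2 * k)) * real l / real m + - pi / 2)" for l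
  proof -
    define y where "y = 2 * pi * real k * real l / real m"
    have y: "2 * pi * of_int (int (2 * k)) * real l / real m = 2 * y"
      by (simp add: y_def)
    have "cos (2 * y + - pi / 2) = sin (2 * y)"
      by (simp add: cos_diff)
    then have sin2: "cos (2 * y + - pi / 2) = 2 * sin y * cos y"
      by (simp only: sin_double)
    have cos2: "cos (2 * y + 0) = 2 * (cos y)\<^sup>2 - 1"
      by (simp add: cos_double_cos)
    have sinsq: "(sin y)\<^sup>2 = 1 - (cos y)\<^sup>2"
      by (simp add: sin_squared_eq)
    show ?thesis
      unfolding y unfolding y_def[symmetric] sin2 cos2 power2_sum power_mult_distrib sinsq
      by (simp add: field_simps)
  qed
  then show ?thesis
    by (simp only: sum.distrib sum_distrib_left[symmetric] sum_cos_progression[OF m] ndvd if_False) simp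
qed

section \<open>Gaussian averages linearising the squared modulus\<close>

lemma real_distribution_std_normal: "real_distribution std_normal_distribution"
  by (simp add: real_distribution_def real_distribution_axioms_def prob_space_normal_density)

text \<open>A normal variable scaled by c = sqrt (2s) has characteristic function exp (- s y^2);
  applied to real and imaginary parts, this replaces a quadratic exponent by linear ones.\<close>

lemma gaussian_average_iexp:
  fixes z :: complex
  assumes "0 \<le> s"
  shows "(CLINT w|std_normal_distribution \<Otimes>\<^sub>M std_normal_distribution.
      iexp (sqrt (2 * s) * (fst w * Re z + snd w * Im z))) = of_real (exp (- s * (cmod z)\<^sup>2))"
proof -
  interpret N: real_distribution std_normal_distribution
    by (rule real_distribution_std_normal)
  interpret NN: pair_prob_space std_normal_distribution std_normal_distribution ..
  let ?c = "sqrt (2 * s)"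
  have single: "(CLINT v|std_normal_distribution. iexp (?c * (v * y))) = of_real (exp (- s * y\<^sup>2))" for y
    using fun_cong[OF char_std_normal_distribution, of "?c * y"] assms
    by (simp add: char_def mult_ac power_mult_distrib)
  have "integrable (std_normal_distribution \<Otimes>\<^sub>M std_normal_distribution)
      (\<lambda>w. iexp (?c * (fst w * Re z + snd w * Im z)))"
    by (rule NN.P.integrable_const_bound[where B = 1]) auto
  then have "(CLINT w|std_normal_distribution \<Otimes>\<^sub>M std_normal_distribution. iexp (?c * (fst w * Re z + snd w * Im z))) =
      (CLINT u|std_normal_distribution. CLINT v|std_normal_distribution. iexp (?c * (u * Re z + v * Im z)))"
    by (subst NN.integral_fst'[symmetric]) auto
  also have "\<dots> = (CLINT u|std_normal_distribution. CLINT v|std_normal_distribution. iexp (?c * (u * Re z)) * iexp (?c * (v * Im z)))"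
    by (simp only: ring_distribs of_real_add exp_add)
  also have "\<dots> = of_real (exp (- s * (Re z)\<^sup>2)) * of_real (exp (- s * (Im z)\<^sup>2))"
    by (simp only: integral_mult_right_zero integral_mult_left_zero single)
  also have "\<dots> = of_real (exp (- s * (cmod z)\<^sup>2))"
    by (simp add: cmod_power2 exp_add[symmetric] ring_distribs flip: of_real_mult)
  finally show ?thesis .
qed

text \<open>The integrand is a multiple of the normal density of variance 1 / (1 + s).\<close>

lemma std_normal_exp_square:
  assumes "0 \<le> s"
  shows "(\<integral>u. exp (- s * u\<^sup>2 / 2) \<partial>std_normal_distribution) = 1 / sqrt (1 + s)"
proof -
  let ?\<sigma> = "1 / sqrt (1 + s)"
  have "(\<integral>u. exp (- s * u\<^sup>2 / 2) \<partial>std_normal_distribution) =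
      (\<integral>u. std_normal_density u * exp (- s * u\<^sup>2 / 2) \<partial>lborel)"
    by (subst integral_density) (auto simp: normal_density_nonneg)
  also have "\<dots> = (\<integral>u. ?\<sigma> * normal_density 0 ?\<sigma> u \<partial>lborel)"
  proof (intro Bochner_Integration.integral_cong refl)
    fix u
    have "exp (- u\<^sup>2 / 2) * exp (- s * u\<^sup>2 / 2) = exp (- (1 + s) * u\<^sup>2 / 2)"
      by (simp add: exp_add[symmetric] field_simps)
    then show "std_normal_density u * exp (- s * u\<^sup>2 / 2) = ?\<sigma> * normal_density 0 ?\<sigma> u"
      using assms by (simp add: normal_density_def power_divide real_sqrt_divide real_sqrt_mult field_simps)
  qed
  also have "\<dots> = ?\<sigma>"
    using integral_normal_density[of ?\<sigma> 0] assms by simp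
  finally show ?thesis .
qed

text \<open>This is the Laplace transform of half the squared norm of a standard Gaussian pair, an
  exponential variable of mean 1.\<close>

lemma gaussian_average_exp_square:
  assumes "0 \<le> s"
  shows "(CLINT w|std_normal_distribution \<Otimes>\<^sub>M std_normal_distribution.
      of_real (exp (- s * ((fst w)\<^sup>2 + (snd w)\<^sup>2) / 2))) = of_real (1 / (1 + s))"
proof -
  interpret N: real_distribution std_normal_distribution
    by (rule real_distribution_std_normal)
  interpret NN: pair_prob_space std_normal_distribution std_normal_distribution ..
  let ?f = "\<lambda>u :: real. exp (- s * u\<^sup>2 / 2)"
  have split: "exp (- s * (u\<^sup>2 + v\<^sup>2) / 2) = ?f u * ?f v" for u v
    by (simp add: exp_add[symmetric] field_simps)
  have "integrable (std_normal_distribution \<Otimes>\<^sub>M std_normal_distribution)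
      (\<lambda>w. exp (- s * ((fst w)\<^sup>2 + (snd w)\<^sup>2) / 2))"
    using assms by (intro NN.P.integrable_const_bound[where B = 1]) auto
  then have "(\<integral>w. exp (- s * ((fst w)\<^sup>2 + (snd w)\<^sup>2) / 2) \<partial>(std_normal_distribution \<Otimes>\<^sub>M std_normal_distribution)) =
      (\<integral>u. \<integral>v. ?f u * ?f v \<partial>std_normal_distribution \<partial>std_normal_distribution)"
    by (subst NN.integral_fst'[symmetric]) (auto simp only: split fst_conv snd_conv)
  also have "\<dots> = 1 / sqrt (1 + s) * (1 / sqrt (1 + s))"
    by (simp only: integral_mult_right_zero integral_mult_left_zero std_normal_exp_square[OF assms])
  also have "\<dots> = 1 / (1 + s)"
    using assms by simp
  finally show ?thesis
    by (simp only: integral_complex_of_real)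
qed

text \<open>The joint characteristic function of the real and imaginary parts of the normalised
  Fourier coefficient, at the point sqrt (2s) w.\<close>

definition dft_char :: "'a measure \<Rightarrow> (nat \<Rightarrow> 'a \<Rightarrow> real) \<Rightarrow> real \<Rightarrow> nat \<Rightarrow> nat \<Rightarrow> real \<times> real \<Rightarrow> complex" where
  "dft_char M x s m k w = (CLINT \<omega>|M. iexp (sqrt (2 * s) * (fst w * Re (dft m (\<lambda>l. x l \<omega>) k / sqrt (real m)) +
     snd w * Im (dft m (\<lambda>l. x l \<omega>) k / sqrt (real m)))))"

lemma borel_measurable_dft [measurable]:
  assumes [measurable]: "\<And>l. x l \<in> borel_measurable M"
  shows "(\<lambda>\<omega>. dft m (\<lambda>l. x l \<omega>) k) \<in> borel_measurable M"
  unfolding dft_def by measurable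

lemma (in prob_space) dft_char_integrable:
  assumes [measurable]: "\<And>l. x l \<in> borel_measurable M"
  shows "integrable (std_normal_distribution \<Otimes>\<^sub>M std_normal_distribution) (dft_char M x s m k)"
    and "cmod (dft_char M x s m k w) \<le> 1"
proof -
  interpret N: real_distribution std_normal_distribution
    by (rule real_distribution_std_normal)
  interpret NN: pair_prob_space std_normal_distribution std_normal_distribution ..
  show le1: "cmod (dft_char M x s m k w) \<le> 1" for w
    unfolding dft_char_def
    by (rule order_trans[OF integral_norm_bound]) (simp add: prob_space)
  show "integrable (std_normal_distribution \<Otimes>\<^sub>M std_normal_distribution) (dft_char M x s m k)"
    using le1 by (intro NN.P.integrable_const_bound[where B = 1]) (auto simp: dft_char_def[abs_def])
qed

text \<open>\<open>gaussian_average_iexp\<close> inside the expectation, followed by Fubini; the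
  integrand has modulus 1.\<close>

lemma (in prob_space) expectation_exp_dft:
  assumes [measurable]: "\<And>l. x l \<in> borel_measurable M" and "0 \<le> s"
  shows "of_real (expectation (\<lambda>\<omega>. exp (- s * (cmod (dft m (\<lambda>l. x l \<omega>) k / sqrt (real m)))\<^sup>2))) =
    (CLINT w|std_normal_distribution \<Otimes>\<^sub>M std_normal_distribution. dft_char M x s m k w)"
proof -
  interpret N: real_distribution std_normal_distribution
    by (rule real_distribution_std_normal)
  interpret NN: pair_prob_space std_normal_distribution std_normal_distribution ..
  interpret MNN: pair_prob_space M "std_normal_distribution \<Otimes>\<^sub>M std_normal_distribution" ..
  let ?g = "\<lambda>\<omega> w. iexp (sqrt (2 * s) * (fst w * Re (dft m (\<lambda>l. x l \<omega>) k / sqrt (real m)) +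
     snd w * Im (dft m (\<lambda>l. x l \<omega>) k / sqrt (real m))))"
  have "of_real (expectation (\<lambda>\<omega>. exp (- s * (cmod (dft m (\<lambda>l. x l \<omega>) k / sqrt (real m)))\<^sup>2))) =
     (CLINT \<omega>|M. CLINT w|std_normal_distribution \<Otimes>\<^sub>M std_normal_distribution. ?g \<omega> w)"
    by (simp only: integral_complex_of_real[symmetric] gaussian_average_iexp[OF assms(2)])
  also have "\<dots> = (CLINT w|std_normal_distribution \<Otimes>\<^sub>M std_normal_distribution. CLINT \<omega>|M. ?g \<omega> w)"
    by (rule MNN.Fubini_integral[symmetric], rule MNN.P.integrable_const_bound[where B = 1])
       (auto simp: split_beta')
  finally show ?thesis
    by (simp only: dft_char_def)
qed

text \<open>The exponent is a linear form in the inputs. Its coefficients \<open>t l\<close> are of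
  order m^(-1/2), and by \<open>sum_sq_trig\<close> their squares sum to s (u^2 + v^2) for w = (u,
  v).\<close>

lemma (in prob_space) dft_char_approx:
  assumes x: "independent_standardized M x" and k: "0 < k" "k < m" "2 * k \<noteq> m" and s: "0 \<le> s"
    and \<delta>: "sqrt (2 * s / real m) * (\<bar>fst w\<bar> + \<bar>snd w\<bar>) \<le> \<delta>"
    and \<epsilon>: "\<And>i. expectation (\<lambda>\<omega>. min (6 * (x i \<omega>)\<^sup>2) (\<delta> * \<bar>x i \<omega>\<bar> ^ 3)) \<le> \<epsilon>"
  shows "cmod (dft_char M x s m k w - of_real (exp (- s * ((fst w)\<^sup>2 + (snd w)\<^sup>2) / 2))) \<le>
    s * ((fst w)\<^sup>2 + (snd w)\<^sup>2) * (\<epsilon> + \<delta>\<^sup>2)"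
proof -
  let ?y = "\<lambda>l. 2 * pi * real k * real l / real m"
  define t where "t l = sqrt (2 * s / real m) * (fst w * cos (?y l) + snd w * sin (?y l))" for l
  have m: "0 < m" using k by simp
  have tl: "\<bar>t l\<bar> \<le> \<delta>" for l
  proof -
    have "\<bar>fst w * cos (?y l) + snd w * sin (?y l)\<bar> \<le> \<bar>fst w\<bar> * 1 + \<bar>snd w\<bar> * 1"
      by (intro order_trans[OF abs_triangle_ineq] add_mono)
         (auto simp only: abs_mult intro!: mult_left_mono abs_cos_le_one abs_sin_le_one)
    then have "\<bar>t l\<bar> \<le> sqrt (2 * s / real m) * (\<bar>fst w\<bar> + \<bar>snd w\<bar>)"
      using s by (simp only: t_def abs_mult) (auto intro!: mult_left_mono)
    then show ?thesis using \<delta> by simp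
  qed
  have sq: "(\<Sum>l<m. (t l)\<^sup>2) = s * ((fst w)\<^sup>2 + (snd w)\<^sup>2)"
    using m s
    by (simp only: t_def power_mult_distrib sum_distrib_left[symmetric] sum_sq_trig[OF k]) simp
  have arg: "sqrt (2 * s) * (fst w * Re (dft m (\<lambda>l. x l \<omega>) k / sqrt (real m)) +
     snd w * Im (dft m (\<lambda>l. x l \<omega>) k / sqrt (real m))) = (\<Sum>l<m. t l * x l \<omega>)" for \<omega>
  proof -
    have "(\<Sum>l<m. t l * x l \<omega>) = sqrt (2 * s / real m) * (\<Sum>l<m. (fst w * cos (?y l) + snd w * sin (?y l)) * x l \<omega>)"
      by (simp add: t_def sum_distrib_left mult.assoc)
    also have "(\<Sum>l<m. (fst w * cos (?y l) + snd w * sin (?y l)) * x l \<omega>) =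
      fst w * (\<Sum>l<m. x l \<omega> * cos (?y l)) + snd w * (\<Sum>l<m. x l \<omega> * sin (?y l))"
      by (simp add: sum_distrib_left sum.distrib ring_distribs mult_ac)
    finally show ?thesis
      by (simp add: dft_def real_sqrt_divide add_divide_distrib ring_distribs)
  qed
  have "cmod (dft_char M x s m k w - of_real (exp (- ((\<Sum>l<m. (t l)\<^sup>2) / 2)))) \<le> (\<Sum>l<m. (t l)\<^sup>2) * (\<epsilon> + \<delta>\<^sup>2)"
    unfolding dft_char_def arg by (rule char_linear_combination_approx[OF x tl \<epsilon>])
  then show ?thesis by (simp add: sq)
qed

text \<open>For fixed \<open>w\<close> the Gaussian approximation is uniform over all frequencies
  that are not self-paired; the at most two others disappear in the average.\<close>

lemma (in prob_space) mean_dft_char_tendsto: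
  assumes x: "independent_standardized M x" and UL: "uniform_Lindeberg M x" and s: "0 \<le> s"
  shows "(\<lambda>m. (\<Sum>k<m. dft_char M x s m k w) / real m) \<longlonglongrightarrow> of_real (exp (- s * ((fst w)\<^sup>2 + (snd w)\<^sup>2) / 2))"
proof (rule LIMSEQ_I)
  fix r :: real assume "0 < r"
  let ?E = "of_real (exp (- s * ((fst w)\<^sup>2 + (snd w)\<^sup>2) / 2)) :: complex"
  have [measurable]: "x i \<in> borel_measurable M" for i
    using x standardizedD(1) by (auto simp: independent_standardized_def)
  define q where "q = s * ((fst w)\<^sup>2 + (snd w)\<^sup>2)"
  have "0 \<le> q" using s by (simp add: q_def)
  \<comment> \<open>Chosen so that q (\<epsilon> + \<delta>^2) \<le> 2 (q + 1) \<epsilon> = r / 2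
    once \<delta>^2 \<le> \<epsilon>.\<close>
  define \<epsilon> where "\<epsilon> = r / (4 * (q + 1))"
  have "0 < \<epsilon>" using \<open>0 < r\<close> \<open>0 \<le> q\<close> by (simp add: \<epsilon>_def)
  obtain d where d: "0 < d" "\<And>i. expectation (\<lambda>\<omega>. min (6 * (x i \<omega>)\<^sup>2) (d * \<bar>x i \<omega>\<bar> ^ 3)) \<le> \<epsilon>"
    using UL \<open>0 < \<epsilon>\<close> unfolding uniform_Lindeberg_def by blast
  \<comment> \<open>Decreasing \<open>d\<close> keeps the Lindeberg bound, because the minimum is
    monotone in \<delta>.\<close>
  define \<delta> where "\<delta> = min d (sqrt \<epsilon>)"
  have \<delta>: "0 < \<delta>" "\<delta> \<le> d" "\<delta>\<^sup>2 \<le> \<epsilon>"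
    using d \<open>0 < \<epsilon>\<close> power_mono[of \<delta> "sqrt \<epsilon>" 2] by (auto simp: \<delta>_def)
  have E\<delta>: "expectation (\<lambda>\<omega>. min (6 * (x i \<omega>)\<^sup>2) (\<delta> * \<bar>x i \<omega>\<bar> ^ 3)) \<le> \<epsilon>" for i
  proof (rule order_trans[OF integral_mono d(2)[of i]])
    fix \<omega> show "min (6 * (x i \<omega>)\<^sup>2) (\<delta> * \<bar>x i \<omega>\<bar> ^ 3) \<le> min (6 * (x i \<omega>)\<^sup>2) (d * \<bar>x i \<omega>\<bar> ^ 3)"
      using \<delta> by (intro min.mono mult_right_mono) auto
  qed (use x d \<delta> in \<open>auto intro!: integrable_min_cube simp: independent_standardized_def\<close>)
  have "(\<lambda>m. sqrt (2 * s / real m) * (\<bar>fst w\<bar> + \<bar>snd w\<bar>)) \<longlonglongrightarrow> sqrt 0 * (\<bar>fst w\<bar> + \<bar>snd w\<bar>)"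
    by (intro tendsto_intros lim_const_over_n)
  then have "\<forall>\<^sub>F m in sequentially. sqrt (2 * s / real m) * (\<bar>fst w\<bar> + \<bar>snd w\<bar>) < \<delta>"
    using \<delta>(1) by (intro order_tendstoD) auto
  \<comment> \<open>Two exceptional frequencies, each with an error of at most 2.\<close>
  moreover have "\<forall>\<^sub>F m in sequentially. 4 / real m < r / 2"
    using order_tendstoD(2)[OF lim_const_over_n[of 4], of "r / 2"] \<open>0 < r\<close> by simp
  moreover have "\<forall>\<^sub>F m :: nat in sequentially. 0 < m"
    by (rule eventually_gt_at_top)
  ultimately have "\<forall>\<^sub>F m in sequentially. norm ((\<Sum>k<m. dft_char M x s m k w) / real m - ?E) < r"
  proof eventually_elim
    case (elim m)
    define S where "S = {k. k < m \<and> (k = 0 \<or> 2 * k = m)}"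
    have sub: "S \<subseteq> {0, m div 2}" by (auto simp: S_def)
    have S: "finite S" "card S \<le> 2" "S \<subseteq> {..<m}"
      using sub finite_subset apply blast
      using card_mono[OF _ sub] card_length[of "[0, m div 2]"] apply simp
      by (auto simp: S_def)
    have generic: "cmod (dft_char M x s m k w - ?E) \<le> r / 2" if "k \<in> {..<m} - S" for k
    proof -
      have "cmod (dft_char M x s m k w - ?E) \<le> q * (\<epsilon> + \<delta>\<^sup>2)"
        unfolding q_def using that elim
        by (intro dft_char_approx[OF x _ _ _ s _ E\<delta>]) (auto simp: S_def)
      also have "\<dots> \<le> (q + 1) * (\<epsilon> + \<epsilon>)"
        using \<open>0 \<le> q\<close> \<open>0 < \<epsilon>\<close> \<delta> by (intro mult_mono) auto
      also have "\<dots> = 4 * (q + 1) * \<epsilon> / 2"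
        by (simp add: algebra_simps)
      also have "4 * (q + 1) * \<epsilon> = r"
        using \<open>0 \<le> q\<close> by (simp add: \<epsilon>_def)
      finally show ?thesis .
    qed
    have special: "cmod (dft_char M x s m k w - ?E) \<le> 2" for k
    proof -
      have "cmod ?E \<le> 1" using s by simp
      moreover have "cmod (dft_char M x s m k w) \<le> 1"
        by (rule dft_char_integrable) simp
      ultimately show ?thesis
        using norm_triangle_ineq4[of "dft_char M x s m k w" ?E] by linarith
    qed
    have "(\<Sum>k<m. dft_char M x s m k w) / real m - ?E = (\<Sum>k<m. dft_char M x s m k w - ?E) / real m"
      using elim by (simp add: sum_subtractf field_simps)
    then have "norm ((\<Sum>k<m. dft_char M x s m k w) / real m - ?E) \<le> (\<Sum>k<m. cmod (dft_char M x s m k w - ?E)) / real m"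
      by (simp add: norm_divide divide_right_mono norm_sum)
    also have "(\<Sum>k<m. cmod (dft_char M x s m k w - ?E)) =
        (\<Sum>k\<in>{..<m} - S. cmod (dft_char M x s m k w - ?E)) + (\<Sum>k\<in>S. cmod (dft_char M x s m k w - ?E))"
      using S by (intro sum.subset_diff) auto
    also have "\<dots> \<le> real (card ({..<m} - S)) * (r / 2) + real (card S) * 2"
      by (intro add_mono sum_bounded_above generic special)
    also have "\<dots> \<le> real m * (r / 2) + 2 * 2"
      using S \<open>0 < r\<close> card_Diff_subset[of S "{..<m}"]
      by (intro add_mono mult_right_mono) auto
    also have "(real m * (r / 2) + 2 * 2) / real m = r / 2 + 4 / real m"
      using elim by (simp add: field_simps)
    finally show ?case
      using elim by (simp add: divide_right_mono)
  qed
  then show "\<exists>n0. \<forall>m\<ge>n0. norm ((\<Sum>k<m. dft_char M x s m k w) / real m - ?E) < r"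
    by (simp add: eventually_sequentially)
qed

text \<open>The averaged characteristic functions are bounded by 1, so the pointwise limit in
  \<open>w\<close> passes through the Gaussian integral.\<close>

lemma (in prob_space) mean_expectation_exp_dft_tendsto:
  assumes x: "independent_standardized M x" and UL: "uniform_Lindeberg M x" and s: "0 \<le> s"
  shows "(\<lambda>m. (\<Sum>k<m. expectation (\<lambda>\<omega>. exp (- s * (cmod (dft m (\<lambda>l. x l \<omega>) k / sqrt (real m)))\<^sup>2))) / real m)
    \<longlonglongrightarrow> 1 / (1 + s)"
proof -
  interpret N: real_distribution std_normal_distribution
    by (rule real_distribution_std_normal)
  interpret NN: pair_prob_space std_normal_distribution std_normal_distribution ..
  have meas: "x i \<in> borel_measurable M" for i
    using x standardizedD(1) by (auto simp: independent_standardized_def)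
  note int = dft_char_integrable[of x, OF meas]
  let ?e = "\<lambda>m k. expectation (\<lambda>\<omega>. exp (- s * (cmod (dft m (\<lambda>l. x l \<omega>) k / sqrt (real m)))\<^sup>2))"
  let ?NN = "std_normal_distribution \<Otimes>\<^sub>M std_normal_distribution"
  have "(\<lambda>m. CLINT w|?NN. (\<Sum>k<m. dft_char M x s m k w) / real m) \<longlonglongrightarrow>
      (CLINT w|?NN. of_real (exp (- s * ((fst w)\<^sup>2 + (snd w)\<^sup>2) / 2)))"
  proof (rule integral_dominated_convergence[where w = "\<lambda>_. 1"])
    show "(\<lambda>w. (\<Sum>k<m. dft_char M x s m k w) / real m) \<in> borel_measurable ?NN" for m
      using borel_measurable_integrable[OF int(1)] by measurable
    show "AE w in ?NN. norm ((\<Sum>k<m. dft_char M x s m k w) / real m) \<le> 1" for m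
    proof (rule AE_I2)
      fix w
      have "norm (\<Sum>k<m. dft_char M x s m k w) \<le> (\<Sum>k<m. 1)"
        by (rule order_trans[OF norm_sum sum_mono]) (use int(2) in auto)
      then show "norm ((\<Sum>k<m. dft_char M x s m k w) / real m) \<le> 1"
        by (cases "m = 0") (auto simp: norm_divide)
    qed
  qed (use mean_dft_char_tendsto[OF x UL s] in auto)
  moreover have "(CLINT w|?NN. (\<Sum>k<m. dft_char M x s m k w) / real m) = of_real ((\<Sum>k<m. ?e m k) / real m)" for m
  proof -
    have "(CLINT w|?NN. (\<Sum>k<m. dft_char M x s m k w) / real m) = (\<Sum>k<m. CLINT w|?NN. dft_char M x s m k w) / real m"
      using int(1) by simp
    then show ?thesis
      by (simp only: expectation_exp_dft[OF meas s, symmetric] of_real_sum of_real_divide)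
  qed
  ultimately have "(\<lambda>m. of_real ((\<Sum>k<m. ?e m k) / real m) :: complex) \<longlonglongrightarrow> of_real (1 / (1 + s))"
    by (simp only: gaussian_average_exp_square[OF s])
  then show ?thesis
    by (simp only: tendsto_of_real_iff)
qed

section \<open>Identification of the limit law\<close>

text \<open>The integrals in the third hypothesis are the moments of \<open>exp (-x\<^sup>2)\<close>, which takes values in \<open>[0, 1]\<close>.\<close>

lemma integral_eq_of_exp_square_moments:
  fixes \<mu> \<nu> :: "real measure" and G :: "real \<Rightarrow> real"
  assumes "real_distribution \<mu>" "real_distribution \<nu>"
    and moments: "\<And>s :: nat. (\<integral>x. exp (- real s * x\<^sup>2) \<partial>\<mu>) = (\<integral>x. exp (- real s * x\<^sup>2) \<partial>\<nu>)"
    and G: "continuous_on {0..1} G"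
  shows "(\<integral>x. G (exp (- x\<^sup>2)) \<partial>\<mu>) = (\<integral>x. G (exp (- x\<^sup>2)) \<partial>\<nu>)"
proof -
  let ?y = "\<lambda>x :: real. exp (- x\<^sup>2)"
  have yI: "?y x \<in> {0..1}" for x by simp
  have "\<exists>C. \<forall>y\<in>{0..1}. \<bar>G y\<bar> \<le> C"
    using compact_imp_bounded[OF compact_continuous_image[OF G]] by (auto simp: bounded_iff)
  then obtain C where C: "\<And>y. y \<in> {0..1} \<Longrightarrow> \<bar>G y\<bar> \<le> C"
    by blast
  have "continuous_on UNIV (\<lambda>x. G (?y x))"
    by (rule continuous_on_compose2[OF G]) (auto intro!: continuous_intros)
  then have Gm: "(\<lambda>x. G (?y x)) \<in> borel_measurable borel"
    by (rule borel_measurable_continuous_onI)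
  \<comment> \<open>A polynomial in exp (- x^2) integrates to a combination of the moments, so a
    uniform approximation of \<open>G\<close> transfers to integrals under any
    \<open>D\<close>.\<close>
  have approx: "\<bar>(\<integral>x. G (?y x) \<partial>D) - (\<Sum>i\<le>n. a i * (\<integral>x. exp (- real i * x\<^sup>2) \<partial>D))\<bar> \<le> e"
    if "real_distribution D" and p: "\<And>y. y \<in> {0..1} \<Longrightarrow> \<bar>G y - (\<Sum>i\<le>n. a i * y ^ i)\<bar> < e"
    for D :: "real measure" and a :: "nat \<Rightarrow> real" and n e
  proof -
    interpret D: real_distribution D by fact
    have intG: "integrable D (\<lambda>x. G (?y x))"
      using Gm C[OF yI] by (intro D.integrable_const_bound[where B = C]) auto
    have int_exp: "integrable D (\<lambda>x. exp (- real i * x\<^sup>2))" for i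
      by (intro D.integrable_const_bound[where B = 1]) auto
    have "(\<Sum>i\<le>n. a i * (\<integral>x. exp (- real i * x\<^sup>2) \<partial>D)) = (\<integral>x. (\<Sum>i\<le>n. a i * exp (- real i * x\<^sup>2)) \<partial>D)"
      using int_exp by simp
    also have "\<dots> = (\<integral>x. (\<Sum>i\<le>n. a i * ?y x ^ i) \<partial>D)"
      by (simp add: exp_of_nat_mult[symmetric])
    finally have "(\<integral>x. G (?y x) \<partial>D) - (\<Sum>i\<le>n. a i * (\<integral>x. exp (- real i * x\<^sup>2) \<partial>D)) =
      (\<integral>x. G (?y x) - (\<Sum>i\<le>n. a i * ?y x ^ i) \<partial>D)"
      using intG int_exp by (simp add: exp_of_nat_mult[symmetric])
    also have "\<bar>\<dots>\<bar> \<le> (\<integral>x. \<bar>G (?y x) - (\<Sum>i\<le>n. a i * ?y x ^ i)\<bar> \<partial>D)"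
      by (rule integral_abs_bound)
    also have "\<dots> \<le> (\<integral>x. e \<partial>D)"
    proof (rule integral_mono)
      show "integrable D (\<lambda>x. \<bar>G (?y x) - (\<Sum>i\<le>n. a i * ?y x ^ i)\<bar>)"
        using intG int_exp by (simp add: exp_of_nat_mult[symmetric])
    qed (use p[OF yI] in \<open>auto intro: less_imp_le\<close>)
    also have "\<dots> = e" using D.prob_space by simp
    finally show ?thesis .
  qed
  have "\<bar>(\<integral>x. G (?y x) \<partial>\<mu>) - (\<integral>x. G (?y x) \<partial>\<nu>)\<bar> \<le> e" if "0 < e" for e
  proof -
    obtain g where g: "real_polynomial_function g" "\<And>y. y \<in> {0..1} \<Longrightarrow> \<bar>G y - g y\<bar> < e / 2"
      using Stone_Weierstrass_real_polynomial_function[OF compact_Icc G, of "e / 2"] \<open>0 < e\<close> by auto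
    obtain a n where "g = (\<lambda>y. \<Sum>i\<le>n. a i * y ^ i)"
      using g(1) real_polynomial_function_iff_sum by blast
    then have p: "\<And>y. y \<in> {0..1} \<Longrightarrow> \<bar>G y - (\<Sum>i\<le>n. a i * y ^ i)\<bar> < e / 2"
      using g(2) by simp
    show ?thesis
    proof -
      let ?S = "\<Sum>i\<le>n. a i * (\<integral>x. exp (- real i * x\<^sup>2) \<partial>\<nu>)"
      have "\<bar>(\<integral>x. G (?y x) \<partial>\<mu>) - ?S\<bar> \<le> e / 2"
        unfolding moments[symmetric] by (rule approx[OF assms(1)]) (rule p)
      moreover have "\<bar>(\<integral>x. G (?y x) \<partial>\<nu>) - ?S\<bar> \<le> e / 2"
        by (rule approx[OF assms(2)]) (rule p)
      ultimately show ?thesis by linarith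
    qed
  qed
  then have "\<bar>(\<integral>x. G (?y x) \<partial>\<mu>) - (\<integral>x. G (?y x) \<partial>\<nu>)\<bar> \<le> 0"
    by (rule field_le_epsilon) simp
  then show ?thesis by simp
qed

text \<open>With x = sqrt (- ln y), cos (t x) keeps oscillating as y tends to 0 when t \<noteq> 0;
  the damping factor forces the limit 0, which is also the value at y = 0.\<close>

lemma continuous_on_powr_cos_ln:
  assumes "0 < \<epsilon>"
  shows "continuous_on {0..1} (\<lambda>y. y powr \<epsilon> * cos (t * sqrt (- ln y)))"
  unfolding continuous_on_eq_continuous_within
proof
  fix y :: real assume y: "y \<in> {0..1}"
  show "continuous (at y within {0..1}) (\<lambda>y. y powr \<epsilon> * cos (t * sqrt (- ln y)))"
  proof (cases "y = 0")
    case True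
    have "((\<lambda>y. y powr \<epsilon> * cos (t * sqrt (- ln y))) \<longlongrightarrow> 0) (at 0 within {0..1})"
    proof (rule Lim_null_comparison)
      show "\<forall>\<^sub>F y in at 0 within {0..1}. norm (y powr \<epsilon> * cos (t * sqrt (- ln y))) \<le> y powr \<epsilon>"
        by (intro always_eventually allI) (simp add: abs_mult mult_left_le)
      show "((\<lambda>y. y powr \<epsilon>) \<longlongrightarrow> 0) (at 0 within {0..1})"
        using assms by (intro tendsto_zero_powrI[where b = \<epsilon>] tendsto_intros)
          (auto simp: eventually_at_filter)
    qed
    then show ?thesis
      using True assms by (simp add: continuous_within)
  next
    case False
    then show ?thesis
      using y by (intro continuous_intros continuous_at_imp_continuous_within) auto
  qed
qed

text \<open>The sine integrals vanish, so the characteristic functions are cosine integrals. These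
  are limits of integrals of continuous functions of exp (- x^2), which the moments determine; Levy
  uniqueness concludes.\<close>

lemma real_distribution_eqI_exp_square:
  fixes \<mu> \<nu> :: "real measure"
  assumes \<mu>: "real_distribution \<mu>" and \<nu>: "real_distribution \<nu>"
    and moments: "\<And>s :: nat. (\<integral>x. exp (- real s * x\<^sup>2) \<partial>\<mu>) = (\<integral>x. exp (- real s * x\<^sup>2) \<partial>\<nu>)"
    and sin: "\<And>t. (\<integral>x. sin (t * x) \<partial>\<mu>) = 0" "\<And>t. (\<integral>x. sin (t * x) \<partial>\<nu>) = 0"
  shows "\<mu> = \<nu>"
proof (rule Levy_uniqueness[OF \<mu> \<nu>], rule ext)
  fix t
  \<comment> \<open>The square root recovers \<bar>x\<bar>, which suffices as the cosine is even;
    the damping exponent 1 / (n + 1) tends to 0.\<close>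
  have lim: "(\<lambda>n. \<integral>x. exp (- x\<^sup>2) powr inverse (real (Suc n)) * cos (t * sqrt (- ln (exp (- x\<^sup>2)))) \<partial>D)
      \<longlonglongrightarrow> (\<integral>x. cos (t * x) \<partial>D)" if "real_distribution D" for D :: "real measure"
  proof -
    interpret D: real_distribution D by fact
    have cos_abs: "cos (t * \<bar>x\<bar>) = cos (t * x)" for x
      by (simp add: abs_if)
    show ?thesis
    proof (rule integral_dominated_convergence[where w = "\<lambda>_. 1"])
      show "AE x in D. (\<lambda>n. exp (- x\<^sup>2) powr inverse (real (Suc n)) * cos (t * sqrt (- ln (exp (- x\<^sup>2)))))
        \<longlonglongrightarrow> cos (t * x)"
      proof (rule AE_I2)
        fix x
        have "(\<lambda>n. exp (- x\<^sup>2) powr inverse (real (Suc n)) * cos (t * x)) \<longlonglongrightarrow> exp (- x\<^sup>2) powr 0 * cos (t * x)"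
          by (intro tendsto_intros LIMSEQ_inverse_real_of_nat) simp
        then show "(\<lambda>n. exp (- x\<^sup>2) powr inverse (real (Suc n)) * cos (t * sqrt (- ln (exp (- x\<^sup>2)))))
            \<longlonglongrightarrow> cos (t * x)"
          by (simp add: cos_abs)
      qed
      show "AE x in D. norm (exp (- x\<^sup>2) powr inverse (real (Suc n)) * cos (t * sqrt (- ln (exp (- x\<^sup>2))))) \<le> 1" for n
        by (intro AE_I2) (simp add: abs_mult exp_powr_real mult_le_one)
    qed auto
  qed
  have "(\<lambda>n. \<integral>x. exp (- x\<^sup>2) powr inverse (real (Suc n)) * cos (t * sqrt (- ln (exp (- x\<^sup>2)))) \<partial>\<mu>) =
    (\<lambda>n. \<integral>x. exp (- x\<^sup>2) powr inverse (real (Suc n)) * cos (t * sqrt (- ln (exp (- x\<^sup>2)))) \<partial>\<nu>)"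
    by (rule ext, rule integral_eq_of_exp_square_moments[OF \<mu> \<nu> moments continuous_on_powr_cos_ln]) simp
  then have cos: "(\<integral>x. cos (t * x) \<partial>\<mu>) = (\<integral>x. cos (t * x) \<partial>\<nu>)"
    using lim[OF \<mu>] lim[OF \<nu>] by (simp only:) (rule LIMSEQ_unique)
  have char: "char D t = Complex (\<integral>x. cos (t * x) \<partial>D) (\<integral>x. sin (t * x) \<partial>D)"
    if "real_distribution D" for D :: "real measure"
  proof -
    interpret D: real_distribution D by fact
    have "integrable D (\<lambda>x. iexp (t * x))"
      by (intro D.integrable_const_bound[where B = 1]) auto
    then have "integrable D (\<lambda>x. cis (t * x))"
      by (simp only: cis_conv_exp)
    from integral_Re[OF this] integral_Im[OF this] show ?thesis
      unfolding char_def cis_conv_exp[symmetric] by (simp add: complex_eq_iff)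
  qed
  show "char \<mu> t = char \<nu> t"
    by (simp add: char[OF \<mu>] char[OF \<nu>] cos sin)
qed

lemma (in prob_space) expectation_bernoulli_mult:
  fixes B R :: "'a \<Rightarrow> real" and f :: "real \<Rightarrow> real"
  assumes B: "B \<in> borel_measurable M" "distr M borel B = Ber p" and p: "0 \<le> p" "p \<le> 1"
    and indep: "indep_var borel B borel R"
    and f [measurable]: "f \<in> borel_measurable borel" and bound: "\<And>x. \<bar>f x\<bar> \<le> C"
  shows "expectation (\<lambda>\<omega>. f (B \<omega> * c * R \<omega>)) = (1 - p) * f 0 + p * expectation (\<lambda>\<omega>. f (c * R \<omega>))"
proof -
  note [measurable] = B(1)
  have R [measurable]: "R \<in> borel_measurable M"
    using indep by (rule indep_var_rv2)
  have "AE y in distr M borel B. y = 0 \<or> y = 1"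
    unfolding B(2) Ber_def by (subst AE_distr_iff) auto
  then have B01: "AE \<omega> in M. B \<omega> = 0 \<or> B \<omega> = 1"
    by (subst (asm) AE_distr_iff) auto
  have "expectation B = (\<integral>y. y \<partial>distr M borel B)"
    by (simp add: integral_distr)
  also have "\<dots> = p"
    using p unfolding B(2) Ber_def by (simp add: integral_distr)
  finally have EB: "expectation B = p" .
  have intB: "integrable M B"
    using B01 by (intro integrable_const_bound[where B = 1]) auto
  have intf: "integrable M (\<lambda>\<omega>. f (c * R \<omega>))"
    using bound by (intro integrable_const_bound[where B = C]) auto
  have indep_f: "indep_var borel B borel (\<lambda>\<omega>. f (c * R \<omega>))"
    using indep_var_compose[OF indep, of "\<lambda>x. x" borel "\<lambda>r. f (c * r)" borel] by (simp add: comp_def)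
  \<comment> \<open>Almost surely \<open>B\<close> is 0 or 1, so the integrand is affine in
    \<open>B\<close>, and independence splits the product.\<close>
  have "expectation (\<lambda>\<omega>. f (B \<omega> * c * R \<omega>)) = expectation (\<lambda>\<omega>. (1 - B \<omega>) * f 0 + B \<omega> * f (c * R \<omega>))"
    using B01 by (intro integral_cong_AE) auto
  also have "\<dots> = expectation (\<lambda>\<omega>. (1 - B \<omega>) * f 0) + expectation (\<lambda>\<omega>. B \<omega> * f (c * R \<omega>))"
    using intB indep_var_integrable[OF indep_f intB intf] by simp
  also have "expectation (\<lambda>\<omega>. B \<omega> * f (c * R \<omega>)) = p * expectation (\<lambda>\<omega>. f (c * R \<omega>))"
    using indep_var_lebesgue_integral[OF indep_f intB intf] EB by simp
  finally show ?thesis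
    using intB EB prob_space by simp
qed

section \<open>Integrals against the symmetrized Rayleigh law\<close>

lemma sym_rayleigh_density_nonneg: "0 \<le> sym_rayleigh_density r"
  by (simp add: sym_rayleigh_density_def)

lemma borel_measurable_sym_rayleigh_density [measurable]: "sym_rayleigh_density \<in> borel_measurable borel"
  unfolding sym_rayleigh_density_def[abs_def] by measurable

text \<open>The density is even, so reflecting r shows that the integral equals its own
  negative.\<close>

lemma (in prob_space) expectation_rayleigh_odd:
  fixes h :: "real \<Rightarrow> real"
  assumes R: "distributed M lborel R (\<lambda>r. ennreal (sym_rayleigh_density r))"
    and h [measurable]: "h \<in> borel_measurable borel" and odd: "\<And>x. h (- x) = - h x"
  shows "expectation (\<lambda>\<omega>. h (R \<omega>)) = 0"
proof -
  have "expectation (\<lambda>\<omega>. h (R \<omega>)) = (\<integral>r. sym_rayleigh_density r * h r \<partial>lborel)"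
    using distributed_integral[OF R] sym_rayleigh_density_nonneg by simp
  moreover have "(\<integral>r. sym_rayleigh_density r * h r \<partial>lborel) =
      (\<integral>r. sym_rayleigh_density (- r) * h (- r) \<partial>lborel)"
    using lborel_integral_real_affine[of "-1" "\<lambda>r. sym_rayleigh_density r * h r" 0] by simp
  ultimately show ?thesis
    by (simp add: odd sym_rayleigh_density_def)
qed

text \<open>Multiplying the density by exp (- s r^2) amounts to rescaling r by sqrt (1 + s), up to a
  constant.\<close>

lemma (in prob_space) expectation_rayleigh_exp_square:
  assumes R: "distributed M lborel R (\<lambda>r. ennreal (sym_rayleigh_density r))" and s: "0 \<le> s"
  shows "expectation (\<lambda>\<omega>. exp (- s * (R \<omega>)\<^sup>2)) = 1 / (1 + s)"
proof -
  \<comment> \<open>The density integrates to 1 because it is the density of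
    \<open>R\<close>.\<close>
  have total: "(\<integral>r. sym_rayleigh_density r \<partial>lborel) = 1"
    using distributed_integral[OF R, of "\<lambda>_. 1"] sym_rayleigh_density_nonneg prob_space by simp
  let ?c = "sqrt (1 + s)"
  have "expectation (\<lambda>\<omega>. exp (- s * (R \<omega>)\<^sup>2)) = (\<integral>r. sym_rayleigh_density r * exp (- s * r\<^sup>2) \<partial>lborel)"
    using distributed_integral[OF R, of "\<lambda>r. exp (- s * r\<^sup>2)"] sym_rayleigh_density_nonneg by simp
  also have "\<dots> = (\<integral>r. sym_rayleigh_density (?c * r) / ?c \<partial>lborel)"
  proof (intro Bochner_Integration.integral_cong refl)
    fix r
    have "exp (- r\<^sup>2) * exp (- s * r\<^sup>2) = exp (- (?c * r)\<^sup>2)"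
      using s by (simp add: exp_add[symmetric] power_mult_distrib algebra_simps)
    then show "sym_rayleigh_density r * exp (- s * r\<^sup>2) = sym_rayleigh_density (?c * r) / ?c"
      using s by (simp add: sym_rayleigh_density_def abs_mult)
  qed
  also have "\<dots> = 1 / (1 + s) * (\<bar>?c\<bar> * (\<integral>r. sym_rayleigh_density (?c * r) \<partial>lborel))"
  proof -
    have "1 / (1 + s) * \<bar>?c\<bar> = 1 / ?c"
      using s by (simp add: field_simps)
    then show ?thesis
      by (simp only: mult.assoc[symmetric]) simp
  qed
  also have "\<bar>?c\<bar> * (\<integral>r. sym_rayleigh_density (?c * r) \<partial>lborel) = 1"
    using lborel_integral_real_affine[of ?c sym_rayleigh_density 0] s total by simp
  finally show ?thesis by simp
qed

section \<open>Spectrum along multiples of the period\<close>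

text \<open>Cutting the range into \<theta> blocks of length m, the blocks differ only by powers of
  a \<theta>-th root of unity, and these sum to 0 unless \<theta> divides k.\<close>

lemma dft_periodic:
  assumes "0 < m" "0 < \<theta>"
  shows "dft (\<theta> * m) (\<lambda>l. b (l mod m)) k = (if \<theta> dvd k then of_nat \<theta> * dft m b (k div \<theta>) else 0)"
proof -
  let ?f = "\<lambda>l. of_real (b (l mod m)) * cis (2 * pi * real k * real l / real (\<theta> * m))"
  have "dft (\<theta> * m) (\<lambda>l. b (l mod m)) k = (\<Sum>r<\<theta>. \<Sum>l\<in>{r * m..<r * m + m}. ?f l)"
    unfolding dft_def by (rule sum.nat_group[symmetric])
  also have "\<dots> = (\<Sum>r<\<theta>. cis (2 * pi * of_int (int k) * real r / real \<theta>) * (\<Sum>p<m. ?f p))"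
  proof (intro sum.cong refl)
    fix r
    have "(\<Sum>l\<in>{r * m..<r * m + m}. ?f l) = (\<Sum>p<m. ?f (p + r * m))"
      using sum.shift_bounds_nat_ivl[of ?f 0 "r * m" m] by (simp add: lessThan_atLeast0 add.commute)
    also have "\<dots> = (\<Sum>p<m. cis (2 * pi * of_int (int k) * real r / real \<theta>) * ?f p)"
    proof (intro sum.cong refl)
      fix p
      have "2 * pi * real k * real (p + r * m) / real (\<theta> * m) =
          2 * pi * of_int (int k) * real r / real \<theta> + 2 * pi * real k * real p / real (\<theta> * m)"
        using assms by (simp add: field_simps)
      then show "?f (p + r * m) = cis (2 * pi * of_int (int k) * real r / real \<theta>) * ?f p"
        by (simp only: cis_mult[symmetric]) simp
    qed
    finally show "(\<Sum>l\<in>{r * m..<r * m + m}. ?f l) = cis (2 * pi * of_int (int k) * real r / real \<theta>) * (\<Sum>p<m. ?f p)"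
      by (simp only: sum_distrib_left)
  qed
  also have "\<dots> = (if \<theta> dvd k then of_nat \<theta> else 0) * (\<Sum>p<m. ?f p)"
    using sum_cis_progression[OF assms(2), of "int k"] by (simp only: sum_distrib_right[symmetric] int_dvd_int_iff)
  also have "\<dots> = (if \<theta> dvd k then of_nat \<theta> * dft m b (k div \<theta>) else 0)"
  proof (cases "\<theta> dvd k")
    case True
    then obtain q where "k = \<theta> * q" by blast
    then show ?thesis
      using assms by (simp add: dft_def mult.left_commute[of _ "real \<theta>"] mult.assoc)
  qed simp
  finally show ?thesis .
qed

text \<open>A cyclic shift changes only the phase; this absorbs the offset 2 of the matrix
  entries.\<close>

lemma cmod_dft_shift:
  assumes "0 < m"
  shows "cmod (dft m (\<lambda>l. b ((l + i) mod m)) k) = cmod (dft m b k)"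
  using dft_shift[OF assms, of b i k] by (simp add: dft_def norm_mult add.commute)

lemma dft_divide: "dft n (\<lambda>l. b l / c) k = dft n b k / of_real c"
  by (simp add: dft_def sum_divide_distrib)

text \<open>For size \<theta> m the modulus is exactly m, which divides the size. The offset 2 stems
  from shifting both zero-based indices by one.\<close>

lemma A_matrix_reverse_circulant:
  assumes "0 < \<theta>"
  shows "A_matrix (real \<theta>) a (\<theta> * m) =
    mat (\<theta> * m) (\<theta> * m) (\<lambda>(i, j). (\<lambda>l. a ((l mod m + 2) mod m) / sqrt (real (\<theta> * m))) ((i + j) mod (\<theta> * m)))"
proof -
  have "real (\<theta> * m) / real \<theta> = real m"
    using assms by simp
  then have floor_eq: "nat \<lfloor>real (\<theta> * m) / real \<theta>\<rfloor> = m"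
    by simp
  have "link (real \<theta>) (\<theta> * m) (Suc i) (Suc j) = ((i + j) mod (\<theta> * m) mod m + 2) mod m" for i j
    unfolding link_def floor_eq by (simp add: mod_mod_cancel mod_simps)
  then show ?thesis
    by (simp add: A_matrix_def)
qed

text \<open>The factor \<theta>^2 from periodicity over the normalisation \<theta> m leaves \<theta>
  / m.\<close>

lemma dft_A_matrix:
  assumes "0 < \<theta>" "0 < m"
  shows "(cmod (dft (\<theta> * m) (\<lambda>l. a ((l mod m + 2) mod m) / sqrt (real (\<theta> * m))) k))\<^sup>2 =
    (if \<theta> dvd k then real \<theta> * (cmod (dft m a (k div \<theta>) / sqrt (real m)))\<^sup>2 else 0)"
proof -
  have "cmod (dft (\<theta> * m) (\<lambda>l. a ((l mod m + 2) mod m) / sqrt (real (\<theta> * m))) k) =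
      (if \<theta> dvd k then real \<theta> * cmod (dft m a (k div \<theta>)) else 0) / sqrt (real (\<theta> * m))"
    unfolding dft_divide dft_periodic[OF assms(2,1), of "\<lambda>l. a ((l + 2) mod m)"]
    by (simp add: norm_divide norm_mult cmod_dft_shift[OF assms(2), where i = 2, simplified])
  then show ?thesis
    using assms by (simp add: norm_divide power_divide power_mult_distrib power2_eq_square[of "real \<theta>"])
qed

text \<open>The transfer to the Borel sets makes it a \<open>real_distribution\<close>, as the weak
  convergence theorems require.\<close>

definition ESD_measure :: "real mat \<Rightarrow> real measure" where
  "ESD_measure A = distr (measure_pmf (pmf_of_multiset (proots (char_poly A)))) borel (\<lambda>x. x)"

lemma real_distribution_ESD_measure: "real_distribution (ESD_measure A)"
  unfolding ESD_measure_def by (rule prob_space.real_distribution_distr) (auto intro: measure_pmf.prob_space_axioms)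

lemma ESD_eq_cdf: "ESD A = cdf (ESD_measure A)"
  by (rule ext) (simp add: ESD_def ESD_measure_def cdf_def measure_distr)

lemma integral_ESD_measure_A_matrix:
  fixes f :: "real \<Rightarrow> real"
  assumes "0 < \<theta>" "0 < m" and [measurable]: "f \<in> borel_measurable borel"
  shows "(\<integral>x. f x \<partial>ESD_measure (A_matrix (real \<theta>) a (\<theta> * m))) =
    (\<Sum>k<\<theta> * m. f (rc_eigenvalue (\<theta> * m) (\<lambda>l. a ((l mod m + 2) mod m) / sqrt (real (\<theta> * m))) k)) / real (\<theta> * m)"
proof -
  have "0 < \<theta> * m" using assms by simp
  from expectation_eigenvalues_reverse_circulant[OF this]
  show ?thesis
    by (simp add: ESD_measure_def integral_distr A_matrix_reverse_circulant[OF assms(1)])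
qed

text \<open>Each block of \<theta> consecutive frequencies has one multiple of \<theta>; the other
  \<theta> - 1 eigenvalues are 0 and contribute 1 each. This produces the weights of the Bernoulli
  variable.\<close>

lemma integral_exp_square_ESD_A_matrix:
  assumes "0 < \<theta>" "0 < m"
  shows "(\<integral>x. exp (- s * x\<^sup>2) \<partial>ESD_measure (A_matrix (real \<theta>) a (\<theta> * m))) =
    (1 - 1 / real \<theta>) + 1 / real \<theta> * ((\<Sum>k<m. exp (- (s * real \<theta>) * (cmod (dft m a k / sqrt (real m)))\<^sup>2)) / real m)"
proof -
  have n: "0 < \<theta> * m" using assms by simp
  let ?b = "\<lambda>l. a ((l mod m + 2) mod m) / sqrt (real (\<theta> * m))"
  let ?F = "\<lambda>k. exp (- s * (if \<theta> dvd k then real \<theta> * (cmod (dft m a (k div \<theta>) / sqrt (real m)))\<^sup>2 else 0))"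
  have "(\<Sum>k<\<theta> * m. exp (- s * (rc_eigenvalue (\<theta> * m) ?b k)\<^sup>2)) = (\<Sum>k<m * \<theta>. ?F k)"
    by (simp only: rc_eigenvalue_sq[OF n] dft_A_matrix[OF assms] mult.commute[of m \<theta>])
  also have "\<dots> = (\<Sum>k<m. \<Sum>r\<in>{k * \<theta>..<k * \<theta> + \<theta>}. ?F r)"
    by (rule sum.nat_group[symmetric])
  also have "\<dots> = (\<Sum>k<m. exp (- (s * real \<theta>) * (cmod (dft m a k / sqrt (real m)))\<^sup>2) + (real \<theta> - 1))"
  proof (intro sum.cong refl)
    fix k
    have "(\<Sum>r\<in>{k * \<theta>..<k * \<theta> + \<theta>}. ?F r) = ?F (k * \<theta>) + (\<Sum>r\<in>{Suc (k * \<theta>)..<k * \<theta> + \<theta>}. ?F r)"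
      using assms by (intro sum.atLeast_Suc_lessThan) simp
    also have "(\<Sum>r\<in>{Suc (k * \<theta>)..<k * \<theta> + \<theta>}. ?F r) = (\<Sum>r\<in>{Suc (k * \<theta>)..<k * \<theta> + \<theta>}. 1)"
    proof (intro sum.cong refl)
      fix r assume r: "r \<in> {Suc (k * \<theta>)..<k * \<theta> + \<theta>}"
      then obtain d where "r = k * \<theta> + d" "0 < d" "d < \<theta>"
        using less_imp_add_positive[of "k * \<theta>" r] by auto
      then have "\<not> \<theta> dvd r"
        using nat_dvd_not_less[of d \<theta>] by (simp add: dvd_add_right_iff)
      then show "?F r = 1" by simp
    qed
    finally show "(\<Sum>r\<in>{k * \<theta>..<k * \<theta> + \<theta>}. ?F r) =
        exp (- (s * real \<theta>) * (cmod (dft m a k / sqrt (real m)))\<^sup>2) + (real \<theta> - 1)"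
      using assms by (simp add: of_nat_diff mult.assoc)
  qed
  also have "\<dots> = (\<Sum>k<m. exp (- (s * real \<theta>) * (cmod (dft m a k / sqrt (real m)))\<^sup>2)) + real m * (real \<theta> - 1)"
    by (simp only: sum.distrib sum_constant card_lessThan)
  finally have "(\<integral>x. exp (- s * x\<^sup>2) \<partial>ESD_measure (A_matrix (real \<theta>) a (\<theta> * m))) =
     ((\<Sum>k<m. exp (- (s * real \<theta>) * (cmod (dft m a k / sqrt (real m)))\<^sup>2)) + real m * (real \<theta> - 1)) / real (\<theta> * m)"
    using integral_ESD_measure_A_matrix[OF assms, of "\<lambda>x. exp (- s * x\<^sup>2)" a] by simp
  also have "\<dots> = (1 - 1 / real \<theta>) + 1 / real \<theta> * ((\<Sum>k<m. exp (- (s * real \<theta>) * (cmod (dft m a k / sqrt (real m)))\<^sup>2)) / real m)"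
    using assms by (simp add: add_divide_distrib diff_divide_distrib ring_distribs)
  finally show ?thesis .
qed

text \<open>After division by the size, the cancellation in the spectrum forces symmetry of the
  limit.\<close>

lemma integral_odd_ESD_A_matrix:
  fixes h :: "real \<Rightarrow> real"
  assumes "0 < \<theta>" "0 < m" "h \<in> borel_measurable borel"
    and "\<And>x. h (- x) = - h x" "\<And>x. \<bar>h x\<bar> \<le> C"
  shows "\<bar>\<integral>x. h x \<partial>ESD_measure (A_matrix (real \<theta>) a (\<theta> * m))\<bar> \<le> 2 * C / real (\<theta> * m)"
  using odd_sum_reverse_circulant[of "\<theta> * m" h C] assms
  by (simp add: integral_ESD_measure_A_matrix abs_divide divide_right_mono)

text \<open>Weak convergence passes to the subsequence \<theta> (m + 1), and bounded continuous
  functions have convergent integrals; \<open>Suc m\<close> keeps the modulus positive.\<close>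

lemma is_LSD_integral_tendsto:
  fixes f :: "real \<Rightarrow> real"
  assumes LSD: "is_LSD M x (real \<theta>) F" and F: "real_distribution \<mu>" "cdf \<mu> = F" and "0 < \<theta>"
    and f: "\<And>x. isCont f x" "\<And>x. \<bar>f x\<bar> \<le> C"
  shows "AE \<omega> in M. (\<lambda>m. \<integral>y. f y \<partial>ESD_measure (A_matrix (real \<theta>) (\<lambda>i. x i \<omega>) (\<theta> * Suc m))) \<longlonglongrightarrow> (\<integral>y. f y \<partial>\<mu>)"
proof -
  have "AE \<omega> in M. weak_conv (\<lambda>n. ESD (A_matrix (real \<theta>) (\<lambda>i. x i \<omega>) n)) F"
    using LSD by (simp add: is_LSD_def)
  then show ?thesis
  proof eventually_elim
    case (elim \<omega>)
    have mono: "strict_mono (\<lambda>m. \<theta> * Suc m)"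
      using \<open>0 < \<theta>\<close> by (simp add: strict_mono_def)
    have "weak_conv_m (\<lambda>m. ESD_measure (A_matrix (real \<theta>) (\<lambda>i. x i \<omega>) (\<theta> * Suc m))) \<mu>"
      unfolding weak_conv_m_def weak_conv_def F(2) ESD_eq_cdf[symmetric]
      using elim LIMSEQ_subseq_LIMSEQ[OF _ mono] by (auto simp: weak_conv_def comp_def)
    then show ?case
      using f by (intro weak_conv_imp_integral_bdd_continuous_conv real_distribution_ESD_measure F(1)) auto
  qed
qed

section \<open>Comparison of the limit with the Bernoulli-Rayleigh product\<close>

theorem theorem2p3:
  fixes \<theta> :: nat
    and M :: "'a measure" and x :: "nat \<Rightarrow> 'a \<Rightarrow> real" and F :: "real \<Rightarrow> real"
    and N\<^sub>X :: "'b measure" and X :: "'b \<Rightarrow> real"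
    and N :: "'c measure" and B R :: "'c \<Rightarrow> real"
  assumes "\<theta> \<ge> 1"
    and "input_sequence M x"
    and "is_LSD M x (real \<theta>) F"
    and "prob_space N\<^sub>X" and "X \<in> borel_measurable N\<^sub>X" and "cdf (distr N\<^sub>X borel X) = F"
    and "prob_space N"
    and "B \<in> borel_measurable N" and "distr N borel B = Ber (1 / real \<theta>)"
    and "distributed N lborel R (\<lambda>r. ennreal (sym_rayleigh_density r))"
    and "prob_space.indep_var N borel B borel R"
  shows "distr N\<^sub>X borel X = distr N borel (\<lambda>\<omega>. B \<omega> * sqrt (real \<theta>) * R \<omega>)"
proof -
  interpret M: prob_space M
    using assms(2) by (simp add: input_sequence_def)
  interpret N: prob_space N by fact
  have \<theta>: "0 < \<theta>" using assms(1) by simp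
  have x: "independent_standardized M x"
    using assms(2) by (auto simp: input_sequence_def bounded_input_def iid_input_def bounded_moments_input_def)
  have UL: "uniform_Lindeberg M x"
    by (rule M.input_sequence_uniform_Lindeberg[OF assms(2)])
  have [measurable]: "x i \<in> borel_measurable M" for i
    using x M.standardizedD(1) by (auto simp: independent_standardized_def)
  note [measurable] = assms(8)
  have R [measurable]: "R \<in> borel_measurable N"
    using assms(11) by (rule N.indep_var_rv2)
  let ?\<mu> = "distr N\<^sub>X borel X" and ?\<nu> = "distr N borel (\<lambda>\<omega>. B \<omega> * sqrt (real \<theta>) * R \<omega>)"
  have \<mu>: "real_distribution ?\<mu>"
    using assms(4,5) by (rule prob_space.real_distribution_distr)
  note LSD = is_LSD_integral_tendsto[OF assms(3) \<mu> assms(6) \<theta>]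
  have p: "0 \<le> 1 / real \<theta>" "1 / real \<theta> \<le> 1" using \<theta> by auto
  note BR = N.expectation_bernoulli_mult[OF assms(8,9) p assms(11), of _ _ "sqrt (real \<theta>)"]
  show ?thesis
  proof (rule real_distribution_eqI_exp_square[OF \<mu>])
    show "real_distribution ?\<nu>"
      by (rule N.real_distribution_distr) measurable
    fix s :: nat
    let ?e = "\<lambda>y :: real. exp (- real s * y\<^sup>2)"
    let ?I = "\<lambda>m \<omega>. \<integral>y. ?e y \<partial>ESD_measure (A_matrix (real \<theta>) (\<lambda>i. x i \<omega>) (\<theta> * Suc m))"
    let ?Z = "\<lambda>m k \<omega>. exp (- (real s * real \<theta>) * (cmod (dft m (\<lambda>i. x i \<omega>) k / sqrt (real m)))\<^sup>2)"
    have I: "?I m \<omega> = (1 - 1 / real \<theta>) + 1 / real \<theta> * ((\<Sum>k<Suc m. ?Z (Suc m) k \<omega>) / real (Suc m))" for m \<omega>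
      by (rule integral_exp_square_ESD_A_matrix[OF \<theta>]) simp
    have int_Z: "integrable M (?Z m k)" for m k
      by (intro M.integrable_const_bound[where B = 1]) auto
    \<comment> \<open>The random integrals are bounded by 1 and converge almost surely to a
      constant, so that constant can be computed from their expectations.\<close>
    have "(\<lambda>m. M.expectation (?I m)) \<longlonglongrightarrow> M.expectation (\<lambda>\<omega>. \<integral>y. ?e y \<partial>?\<mu>)"
    proof (rule integral_dominated_convergence[where w = "\<lambda>_. 1"])
      show "AE \<omega> in M. (\<lambda>m. ?I m \<omega>) \<longlonglongrightarrow> (\<integral>y. ?e y \<partial>?\<mu>)"
        by (rule LSD[where C = 1]) (auto intro!: continuous_intros)
      show "?I m \<in> borel_measurable M" for m
        unfolding I by measurable
      show "AE \<omega> in M. norm (?I m \<omega>) \<le> 1" for m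
      proof (rule AE_I2)
        fix \<omega>
        interpret D: real_distribution "ESD_measure (A_matrix (real \<theta>) (\<lambda>i. x i \<omega>) (\<theta> * Suc m))"
          by (rule real_distribution_ESD_measure)
        have "norm (?I m \<omega>) \<le> D.expectation (\<lambda>y. norm (?e y))"
          by (rule integral_norm_bound)
        also have "\<dots> \<le> 1"
          by (intro D.integral_le_const D.integrable_const_bound[where B = 1]) (auto simp del: mult_Suc_right)
        finally show "norm (?I m \<omega>) \<le> 1" .
      qed
    qed auto
    then have lim1: "(\<lambda>m. M.expectation (?I m)) \<longlonglongrightarrow> (\<integral>y. ?e y \<partial>?\<mu>)"
      by (simp add: M.prob_space)
    have "M.expectation (?I m) = (1 - 1 / real \<theta>) + 1 / real \<theta> * ((\<Sum>k<Suc m. M.expectation (?Z (Suc m) k)) / real (Suc m))" for m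
      unfolding I using int_Z M.prob_space by (simp del: sum.lessThan_Suc of_nat_Suc)
    moreover have "(\<lambda>m. (1 - 1 / real \<theta>) + 1 / real \<theta> * ((\<Sum>k<Suc m. M.expectation (?Z (Suc m) k)) / real (Suc m)))
        \<longlonglongrightarrow> (1 - 1 / real \<theta>) + 1 / real \<theta> * (1 / (1 + real s * real \<theta>))"
      by (intro tendsto_intros LIMSEQ_Suc[OF M.mean_expectation_exp_dft_tendsto[OF x UL]]) simp
    ultimately have "(\<lambda>m. M.expectation (?I m)) \<longlonglongrightarrow> (1 - 1 / real \<theta>) + 1 / real \<theta> * (1 / (1 + real s * real \<theta>))"
      by (simp only:)
    with lim1 have "(\<integral>y. ?e y \<partial>?\<mu>) = (1 - 1 / real \<theta>) + 1 / real \<theta> * (1 / (1 + real s * real \<theta>))"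
      by (rule LIMSEQ_unique)
    \<comment> \<open>Scaling \<open>R\<close> by sqrt \<theta> multiplies the parameter s by
      \<theta>.\<close>
    also have "1 / (1 + real s * real \<theta>) = N.expectation (\<lambda>\<omega>. ?e (sqrt (real \<theta>) * R \<omega>))"
      using N.expectation_rayleigh_exp_square[OF assms(10), of "real s * real \<theta>"]
      by (simp add: power_mult_distrib mult_ac)
    \<comment> \<open>The first summand is the atom at 0, where the test function equals 1.\<close>
    also have "(1 - 1 / real \<theta>) + 1 / real \<theta> * \<dots> = N.expectation (\<lambda>\<omega>. ?e (B \<omega> * sqrt (real \<theta>) * R \<omega>))"
      by (subst BR[of ?e 1]) auto
    also have "\<dots> = (\<integral>y. ?e y \<partial>?\<nu>)"
      by (simp add: integral_distr)
    finally show "(\<integral>y. ?e y \<partial>?\<mu>) = (\<integral>y. ?e y \<partial>?\<nu>)" .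
  next
    fix t :: real
    have "AE \<omega> in M. (\<lambda>m. \<integral>y. sin (t * y) \<partial>ESD_measure (A_matrix (real \<theta>) (\<lambda>i. x i \<omega>) (\<theta> * Suc m)))
        \<longlonglongrightarrow> (\<integral>y. sin (t * y) \<partial>?\<mu>)"
      by (rule LSD[where C = 1]) (auto intro!: continuous_intros)
    then have "AE \<omega> in M. (\<integral>y. sin (t * y) \<partial>?\<mu>) = 0"
    proof eventually_elim
      case (elim \<omega>)
      have "(\<lambda>m. \<integral>y. sin (t * y) \<partial>ESD_measure (A_matrix (real \<theta>) (\<lambda>i. x i \<omega>) (\<theta> * Suc m))) \<longlonglongrightarrow> 0"
      proof (rule Lim_null_comparison)
        show "\<forall>\<^sub>F m in sequentially. norm (\<integral>y. sin (t * y) \<partial>ESD_measure (A_matrix (real \<theta>) (\<lambda>i. x i \<omega>) (\<theta> * Suc m)))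
            \<le> 2 / real \<theta> / real (Suc m)"
          using integral_odd_ESD_A_matrix[OF \<theta> zero_less_Suc, of "\<lambda>y. sin (t * y)" 1]
          by (intro always_eventually allI) (simp del: mult_Suc_right of_nat_Suc)
        show "(\<lambda>m. 2 / real \<theta> / real (Suc m)) \<longlonglongrightarrow> 0"
          by (rule LIMSEQ_Suc[OF lim_const_over_n])
      qed
      with elim show ?case by (rule LIMSEQ_unique)
    qed
    \<comment> \<open>The equation does not involve \<omega>, so its validity almost everywhere
      under a probability measure suffices.\<close>
    then show "(\<integral>y. sin (t * y) \<partial>?\<mu>) = 0"
      by (simp add: M.AE_const)
    \<comment> \<open>The atom at 0 contributes sin 0 = 0, and the rest is an odd function of the
      symmetric variable \<open>R\<close>.\<close>
    have "(\<integral>y. sin (t * y) \<partial>?\<nu>) = N.expectation (\<lambda>\<omega>. sin (t * (B \<omega> * sqrt (real \<theta>) * R \<omega>)))"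
      by (simp add: integral_distr)
    also have "\<dots> = 1 / real \<theta> * N.expectation (\<lambda>\<omega>. sin (t * (sqrt (real \<theta>) * R \<omega>)))"
      by (subst BR[of "\<lambda>y. sin (t * y)" 1]) auto
    also have "N.expectation (\<lambda>\<omega>. sin (t * (sqrt (real \<theta>) * R \<omega>))) = 0"
      by (rule N.expectation_rayleigh_odd[OF assms(10), of "\<lambda>r. sin (t * (sqrt (real \<theta>) * r))"]) auto
    finally show "(\<integral>y. sin (t * y) \<partial>?\<nu>) = 0" by simp
  qed
qed

end
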